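(* Let $(X, \mathcal{B}, \mu)$ be a probability measure space, and let $A \subseteq X$ be a measurable set. Let $T_1, \dotsc, T_m$ be commuting invertible measure-preserving transformations on $X$. Let $f_1, \dotsc, f_m \in \mathrm{Int}[\vec{z}\,]$, where $\vec{z} = (z_1, \dotsc, z_n)$, be polynomials such that $f_i(0) = 0$ for all $i = 1, \dotsc, m$. (1) For any idempotent ultrafilter $p \in \beta\mathbb{Z}^n$, one has $$p\text{-}\lim_{\vec{z}}\ \mu\Bigl(A \cap \Bigl(\prod_{i=1}^{m} T_i^{f_i(\vec{z})}\Bigr)^{-1} A\Bigr) \ge \mu(A)^2.$$ (2) For any uncongested idempotent ultrafilter $q \in \beta\mathcal{F}$ and any IP-sets $w_\bullet^{j} : \mathcal{F} \to \mathbb{N}$, $j = 1, \dotsc, n$, one has $$q\text{-}\lim_{\alpha}\ \mu\Bigl(A \cap \Bigl(\prod_{i=1}^{m} T_i^{f_i(w_\alpha^1, \dotsc, w_\alpha^n)}\Bigr)^{-1} A\Bigr) \ge \mu(A)^2.$$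
   Context: Here $\mathbb{N} = \{0,1,2,\dotsc\}$, and $\mathcal{F}$ is the set of all nonempty finite subsets of $\mathbb{N}$, a commutative semigroup under union $\cup$; $\mathbb{Z}^n$ is a semigroup under addition. An ultrafilter $p$ on a commutative semigroup $(S,\circ)$ is a collection of subsets of $S$ such that $S \in p$, $\emptyset \notin p$; $p$ is closed under supersets and finite intersections; and for every $A \subseteq S$ either $A \in p$ or $S \setminus A \in p$. The set of all ultrafilters on $S$ is $\beta S$. For $p, q \in \beta S$ the product $p \circ q \in \beta S$ is defined by: $A \in p \circ q$ if and only if $\{s \in S : \{t \in S : s \circ t \in A\} \in q\} \in p$. An ultrafilter $p$ is idempotent if $p \circ p = p$. For $n\in\mathbb{N}$ let $C_n = \{\alpha \in \mathcal{F} : n \in \alpha\}$; an ultrafilter $p \in \beta\mathcal{F}$ is uncongested if $C_n \notin p$ for every $n \in \mathbb{N}$. An IP-set is a map $n_\bullet : \mathcal{F} \to \mathbb{N}$, $\alpha \mapsto n_\alpha = \sum_{i \in \alpha} n_i$, where $(n_i)_{i \in \mathbb{N}}$ is a sequence of positive integers. For a map $f : S \to Y$ into a topological space, $y = p\text{-}\lim_s f(s)$ means that $f^{-1}(U) \in p$ for every neighborhood $U$ of $y$; when $Y$ is compact (Hausdorff), e.g. $Y=[0,1]$, such limits exist and are unique. $\mathrm{Int}[\vec{z}\,]$ denotes the additive group of polynomials in $z_1, \dotsc, z_n$ with rational coefficients that take integer values at all integer arguments. *)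

theory Defs
  imports "HOL-Probability.Probability" "HOL-Library.Poly_Mapping"
begin

section \<open>Ultrafilters on a semigroup\<close>

definition ultrafilter_on :: "'s set \<Rightarrow> 's set set \<Rightarrow> bool" where
  "ultrafilter_on S p \<longleftrightarrow>
     p \<subseteq> Pow S \<and> S \<in> p \<and> {} \<notin> p \<and>
     (\<forall>A B. A \<in> p \<longrightarrow> A \<subseteq> B \<longrightarrow> B \<subseteq> S \<longrightarrow> B \<in> p) \<and>
     (\<forall>A B. A \<in> p \<longrightarrow> B \<in> p \<longrightarrow> A \<inter> B \<in> p) \<and>
     (\<forall>A. A \<subseteq> S \<longrightarrow> A \<in> p \<or> S - A \<in> p)"

definition ultrafilters :: "'s set \<Rightarrow> 's set set set" where
  "ultrafilters S = {p. ultrafilter_on S p}"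

definition uf_prod ::
  "'s set \<Rightarrow> ('s \<Rightarrow> 's \<Rightarrow> 's) \<Rightarrow> 's set set \<Rightarrow> 's set set \<Rightarrow> 's set set" where
  "uf_prod S opr p q = {A. A \<subseteq> S \<and> {s \<in> S. {t \<in> S. opr s t \<in> A} \<in> q} \<in> p}"

definition uf_idempotent :: "'s set \<Rightarrow> ('s \<Rightarrow> 's \<Rightarrow> 's) \<Rightarrow> 's set set \<Rightarrow> bool" where
  "uf_idempotent S opr p \<longleftrightarrow> uf_prod S opr p p = p"

text \<open>Arbitrary (not just open) neighborhoods are used, hence \<open>interior\<close>.\<close>

definition has_uf_lim ::
  "'s set \<Rightarrow> 's set set \<Rightarrow> ('s \<Rightarrow> 'y::topological_space) \<Rightarrow> 'y \<Rightarrow> bool" where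
  "has_uf_lim S p f y \<longleftrightarrow> (\<forall>U. y \<in> interior U \<longrightarrow> {s \<in> S. f s \<in> U} \<in> p)"

text \<open>The value is only meaningful when the limit exists and is unique; for ultrafilters and
  maps into a compact subset of a Hausdorff space this is \<open>has_uf_lim_uf_lim\<close> and
  \<open>has_uf_lim_unique\<close> below.\<close>

definition uf_lim :: "'s set \<Rightarrow> 's set set \<Rightarrow> ('s \<Rightarrow> 'y::topological_space) \<Rightarrow> 'y" where
  "uf_lim S p f = (THE y. has_uf_lim S p f y)"

lemma has_uf_lim_unique:
  fixes f :: "'s \<Rightarrow> 'y::t2_space"
  assumes p: "p \<in> ultrafilters S" and y: "has_uf_lim S p f y" and z: "has_uf_lim S p f z"
  shows "y = z"
proof (rule ccontr)
  assume "y \<noteq> z"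
  then obtain U V where UV: "open U" "open V" "y \<in> U" "z \<in> V" "U \<inter> V = {}"
    using hausdorff by metis
  have "{s \<in> S. f s \<in> U} \<in> p" "{s \<in> S. f s \<in> V} \<in> p"
    using y z UV by (auto simp: has_uf_lim_def interior_open)
  then have "{s \<in> S. f s \<in> U} \<inter> {s \<in> S. f s \<in> V} \<in> p"
    using p by (simp add: ultrafilters_def ultrafilter_on_def)
  moreover have "{s \<in> S. f s \<in> U} \<inter> {s \<in> S. f s \<in> V} = {}"
    using UV(5) by auto
  ultimately show False
    using p by (simp add: ultrafilters_def ultrafilter_on_def)
qed

lemma has_uf_lim_exists:
  fixes f :: "'s \<Rightarrow> 'y::topological_space"
  assumes p: "p \<in> ultrafilters S" and K: "compact K" and f: "f ` S \<subseteq> K"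
  shows "\<exists>y\<in>K. has_uf_lim S p f y"
proof (rule ccontr)
  assume neg: "\<not> (\<exists>y\<in>K. has_uf_lim S p f y)"
  define C where "C = {U. open U \<and> {s \<in> S. f s \<in> U} \<notin> p}"
  have up: "B \<in> p" if "A \<in> p" "A \<subseteq> B" "B \<subseteq> S" for A B
    using p that unfolding ultrafilters_def ultrafilter_on_def mem_Collect_eq by meson
  have compl: "A \<in> p \<or> S - A \<in> p" if "A \<subseteq> S" for A
    using p that by (simp add: ultrafilters_def ultrafilter_on_def)
  have int: "A \<inter> B \<in> p" if "A \<in> p" "B \<in> p" for A B
    using p that unfolding ultrafilters_def ultrafilter_on_def mem_Collect_eq by meson
  have Sp: "S \<in> p" and ep: "{} \<notin> p"
    using p by (simp_all add: ultrafilters_def ultrafilter_on_def)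
  have "K \<subseteq> \<Union>C"
  proof
    fix y assume "y \<in> K"
    then obtain U where U: "y \<in> interior U" "{s \<in> S. f s \<in> U} \<notin> p"
      using neg unfolding has_uf_lim_def by blast
    have "{s \<in> S. f s \<in> interior U} \<notin> p"
      using U(2) up[of "{s \<in> S. f s \<in> interior U}" "{s \<in> S. f s \<in> U}"] interior_subset[of U]
      by blast
    then show "y \<in> \<Union>C"
      using U(1) by (auto simp: C_def)
  qed
  moreover have "open U" if "U \<in> C" for U
    using that by (simp add: C_def)
  ultimately obtain D where D: "D \<subseteq> C" "finite D" "K \<subseteq> \<Union>D"
    using compactE[OF K] by metis
  have "{s \<in> S. f s \<notin> \<Union>D} \<in> p"
    using D(2,1)
  proof (induction D rule: finite_induct)
    case empty
    then show ?case using Sp by simp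
  next
    case (insert U D)
    have "S - {s \<in> S. f s \<in> U} \<in> p"
      using compl[of "{s \<in> S. f s \<in> U}"] insert.prems by (simp add: C_def)
    then have "(S - {s \<in> S. f s \<in> U}) \<inter> {s \<in> S. f s \<notin> \<Union>D} \<in> p"
      using int insert.IH insert.prems by simp
    moreover have "(S - {s \<in> S. f s \<in> U}) \<inter> {s \<in> S. f s \<notin> \<Union>D} = {s \<in> S. f s \<notin> \<Union>(insert U D)}"
      by auto
    ultimately show ?case by simp
  qed
  moreover have "{s \<in> S. f s \<notin> \<Union>D} = {}"
    using D(3) f by auto
  ultimately have "{} \<in> p" by (rule back_subst[where P = "\<lambda>B. B \<in> p"])
  with ep show False ..
qed

lemma has_uf_lim_uf_lim:
  fixes f :: "'s \<Rightarrow> 'y::t2_space"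
  assumes "p \<in> ultrafilters S" and "compact K" and "f ` S \<subseteq> K"
  shows "has_uf_lim S p f (uf_lim S p f)"
proof -
  obtain y where "has_uf_lim S p f y"
    using has_uf_lim_exists[OF assms] by blast
  then have "\<exists>!y. has_uf_lim S p f y"
    using has_uf_lim_unique[OF assms(1)] by blast
  then show ?thesis
    unfolding uf_lim_def by (rule theI')
qed


section \<open>Finite nonempty sets of natural numbers and IP-sets\<close>

definition fin_sets :: "nat set set" where
  "fin_sets = {\<alpha>. finite \<alpha> \<and> \<alpha> \<noteq> {}}"

definition uncongested :: "nat set set set \<Rightarrow> bool" where
  "uncongested q \<longleftrightarrow> (\<forall>n. {\<alpha> \<in> fin_sets. n \<in> \<alpha>} \<notin> q)"

text \<open>Values outside \<open>fin_sets\<close> are irrelevant.\<close>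

definition ip_set :: "(nat set \<Rightarrow> nat) \<Rightarrow> bool" where
  "ip_set w \<longleftrightarrow> (\<exists>x :: nat \<Rightarrow> nat. (\<forall>i. x i > 0) \<and> (\<forall>\<alpha>\<in>fin_sets. w \<alpha> = (\<Sum>i\<in>\<alpha>. x i)))"


section \<open>Integer-valued polynomials\<close>

text \<open>A polynomial maps each monomial, given by its exponents, to its coefficient;
  the variables are indexed by the finite type \<open>'n\<close>.\<close>

type_synonym 'n rat_poly = "('n \<Rightarrow>\<^sub>0 nat) \<Rightarrow>\<^sub>0 rat"

definition poly_val :: "'n::finite rat_poly \<Rightarrow> int ^ 'n \<Rightarrow> rat" where
  "poly_val f z =
     (\<Sum>e\<in>Poly_Mapping.keys f. Poly_Mapping.lookup f e *
        (\<Prod>j\<in>UNIV. of_int (z $ j) ^ Poly_Mapping.lookup e j))"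

definition int_polys :: "'n::finite rat_poly set" where
  "int_polys = {f. \<forall>z. poly_val f z \<in> \<int>}"

text \<open>For \<open>f \<in> int_polys\<close> the floor does not change the value, only its type.\<close>

definition int_poly_val :: "'n::finite rat_poly \<Rightarrow> int ^ 'n \<Rightarrow> int" where
  "int_poly_val f z = \<lfloor>poly_val f z\<rfloor>"


section \<open>Invertible measure-preserving transformations\<close>

definition invertible_mpt :: "'a measure \<Rightarrow> ('a \<Rightarrow> 'a) \<Rightarrow> bool" where
  "invertible_mpt M T \<longleftrightarrow>
     bij_betw T (space M) (space M) \<and>
     T \<in> measurable M M \<and> inv_into (space M) T \<in> measurable M M \<and>
     (\<forall>B\<in>sets M. emeasure M (T -` B \<inter> space M) = emeasure M B)"

text \<open>Only the values on \<open>space M\<close> are relevant.\<close>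

definition trans_power :: "'a measure \<Rightarrow> ('a \<Rightarrow> 'a) \<Rightarrow> int \<Rightarrow> 'a \<Rightarrow> 'a" where
  "trans_power M T k =
     (if 0 \<le> k then T ^^ nat k else inv_into (space M) T ^^ nat (- k))"

text \<open>The composition of \<open>T\<^sub>1\<^bsup>k\<^sub>1\<^esup>, \<dots>, T\<^sub>m\<^bsup>k\<^sub>m\<^esup>\<close>.\<close>

definition trans_prod ::
  "'a measure \<Rightarrow> (nat \<Rightarrow> 'a \<Rightarrow> 'a) \<Rightarrow> nat \<Rightarrow> (nat \<Rightarrow> int) \<Rightarrow> 'a \<Rightarrow> 'a" where
  "trans_prod M T m k = foldr (\<circ>) (map (\<lambda>i. trans_power M (T i) (k i)) [1..<Suc m]) id"

end

theory Submission
  imports Defs "HOL-Library.Function_Algebras"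
begin

text \<open>
  Let \<open>h\<close> be the indicator of \<open>A\<close> minus the constant \<open>\<mu>(A)\<close>, and let \<open>U\<^sup>k\<close>, for \<open>k\<close> in \<open>\<int>\<^sup>m\<close>, be
  the unitary action of the transformations on square-integrable functions. The measure of the
  intersection in the statement is \<open>\<mu>(A)\<^sup>2 + \<langle>U\<^bsup>f(z)\<^esup> h, h\<rangle>\<close>, so the claim is that the limit of this inner
  product is nonnegative. It is, because the weak operator limit \<open>P\<^sub>f\<close> of \<open>U\<^bsup>f(z)\<^esup>\<close> along an
  idempotent ultrafilter is an orthogonal projection, and \<open>\<langle>P\<^sub>f h, h\<rangle> = \<parallel>P\<^sub>f h\<parallel>\<^sup>2\<close> for a projection.
  Since \<open>P\<^sub>f\<close> is a contraction, being a projection means just \<open>P\<^sub>f P\<^sub>f = P\<^sub>f\<close>; this is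
  \<open>is_idem_polymap\<close>, the heart of the proof.

  It is proved by induction on the degree of \<open>f\<close>. The defect \<open>D\<^sub>a f(b) = f(a + b) - f(a) - f(b)\<close> has
  smaller degree in \<open>b\<close>, so that the limit operators of all defects are projections by induction;
  they commute. Two situations are easy for a vector \<open>\<xi>\<close>. If \<open>P\<^bsub>D\<^sub>a f\<^esub> \<xi> = \<xi>\<close> for almost all \<open>a\<close>, then
  \<open>U\<^bsup>f(a + b)\<^esup> \<xi>\<close> is close to \<open>U\<^bsup>f(a)\<^esup> U\<^bsup>f(b)\<^esup> \<xi>\<close>, and the idempotence of the ultrafilter gives
  \<open>P\<^sub>f \<xi> = P\<^sub>f P\<^sub>f \<xi>\<close> (\<open>idem_if_defects_fixed\<close>). If \<open>P\<^bsub>D\<^sub>a f\<^esub> \<xi>\<close> is small for almost all \<open>a\<close>, then an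
  inequality of van der Corput type shows that \<open>P\<^sub>f \<xi>\<close> is small
  (\<open>norm_lim_op_le_if_defects_small\<close>). To reduce to these two cases, consider the
  subgroup \<open>Fix \<xi>\<close> of those \<open>g\<close> of smaller degree with \<open>P\<^sub>g \<xi> = \<xi>\<close>. The polynomial maps of bounded degree
  form a Noetherian group (\<open>noetherian_polymaps\<close>), so the claim for \<open>\<xi>\<close> may assume the claim for
  all vectors fixed by a larger subgroup. Unless almost all defects lie in \<open>Fix \<xi>\<close>, split off from
  \<open>\<xi>\<close> components \<open>P\<^sub>g \<eta>\<close> with \<open>g\<close> outside \<open>Fix \<xi>\<close>, which are fixed by a larger subgroup, until the
  norm of the remainder \<open>\<eta>\<close> is nearly minimal. Then every \<open>P\<^sub>g \<eta>\<close> is small, and the second case applies.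

  Only the correlations of the functions \<open>U\<^sup>k h\<close> enter, so these functions are replaced by vectors
  of the sequence space with the same inner products (\<open>gram_realization\<close>), where bounded
  families have weak limits. A vector \<open>\<xi>\<close> is represented by the family of all \<open>U\<^sup>k \<xi>\<close>, on which the
  group acts by translating the index \<open>k\<close>; that the action is unitary becomes the joint
  stationarity of the families involved.

  The second statement is the first one for another ultrafilter: the image of \<open>q\<close> under
  \<open>\<alpha> \<mapsto> (w\<^sup>1\<^sub>\<alpha>, \<dots>, w\<^sup>n\<^sub>\<alpha>)\<close> is idempotent, because almost all \<open>\<beta>\<close> are disjoint from a given \<open>\<alpha>\<close>, and the
  values of an IP-set add up over disjoint unions.
\<close>


section \<open>The Hilbert space of square-summable sequences\<close>

lemma summable_mult_of_squares:
  fixes x y :: "nat \<Rightarrow> real"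
  assumes "summable (\<lambda>i. (x i)\<^sup>2)" "summable (\<lambda>i. (y i)\<^sup>2)"
  shows "summable (\<lambda>i. x i * y i)"
proof (rule summable_comparison_test')
  show "summable (\<lambda>i. (x i)\<^sup>2 + (y i)\<^sup>2)"
    using assms by (rule summable_add)
  fix i :: nat
  have "2 * \<bar>x i\<bar> * \<bar>y i\<bar> \<le> \<bar>x i\<bar>\<^sup>2 + \<bar>y i\<bar>\<^sup>2"
    by (rule sum_squares_bound)
  moreover have "0 \<le> \<bar>x i\<bar> * \<bar>y i\<bar>" by simp
  ultimately show "norm (x i * y i) \<le> (x i)\<^sup>2 + (y i)\<^sup>2"
    unfolding real_norm_def abs_mult power2_abs by linarith
qed

lemma summable_square_add:
  fixes x y :: "nat \<Rightarrow> real"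
  assumes "summable (\<lambda>i. (x i)\<^sup>2)" "summable (\<lambda>i. (y i)\<^sup>2)"
  shows "summable (\<lambda>i. (x i + y i)\<^sup>2)"
  unfolding power2_sum mult.assoc
  by (intro summable_add summable_mult summable_mult_of_squares assms)

typedef ell2 = "{x :: nat \<Rightarrow> real. summable (\<lambda>i. (x i)\<^sup>2)}"
  morphisms coord Abs_ell2
  by (rule exI[of _ "\<lambda>_. 0"]) simp

setup_lifting type_definition_ell2

lemma summable_coord_square: "summable (\<lambda>i. (coord x i)\<^sup>2)"
  using coord by simp

lemma ell2_eqI: "(\<And>i. coord x i = coord y i) \<Longrightarrow> x = y"
  by (simp add: coord_inject[symmetric] ext)

instantiation ell2 :: ab_group_add
begin
lift_definition zero_ell2 :: ell2 is "\<lambda>_. 0" by simp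
lift_definition plus_ell2 :: "ell2 \<Rightarrow> ell2 \<Rightarrow> ell2" is "\<lambda>x y i. x i + y i"
  by (rule summable_square_add)
lift_definition uminus_ell2 :: "ell2 \<Rightarrow> ell2" is "\<lambda>x i. - x i" by simp
lift_definition minus_ell2 :: "ell2 \<Rightarrow> ell2 \<Rightarrow> ell2" is "\<lambda>x y i. x i - y i"
  subgoal for x y using summable_square_add[of x "\<lambda>i. - y i"] by simp
  done
instance
  by standard (rule ell2_eqI, simp add: plus_ell2.rep_eq zero_ell2.rep_eq uminus_ell2.rep_eq
      minus_ell2.rep_eq)+
end

instantiation ell2 :: real_vector
begin
lift_definition scaleR_ell2 :: "real \<Rightarrow> ell2 \<Rightarrow> ell2" is "\<lambda>r x i. r * x i"
  by (simp add: power_mult_distrib summable_mult)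
instance
  by standard (rule ell2_eqI, simp add: plus_ell2.rep_eq scaleR_ell2.rep_eq algebra_simps)+
end

instantiation ell2 :: real_inner
begin
definition inner_ell2 :: "ell2 \<Rightarrow> ell2 \<Rightarrow> real" where
  "inner_ell2 x y = suminf (\<lambda>i. coord x i * coord y i)"
definition norm_ell2 :: "ell2 \<Rightarrow> real" where "norm_ell2 x = sqrt (x \<bullet> x)"
definition sgn_ell2 :: "ell2 \<Rightarrow> ell2" where "sgn_ell2 x = x /\<^sub>R norm x"
definition dist_ell2 :: "ell2 \<Rightarrow> ell2 \<Rightarrow> real" where "dist_ell2 x y = norm (x - y)"
definition uniformity_ell2 :: "(ell2 \<times> ell2) filter" where
  "uniformity_ell2 = (INF e\<in>{0 <..}. principal {(x, y). dist x y < e})"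
definition open_ell2 :: "ell2 set \<Rightarrow> bool" where
  "open_ell2 U = (\<forall>x\<in>U. eventually (\<lambda>(x', y). x' = x \<longrightarrow> y \<in> U) uniformity)"
instance
proof
  fix x y z :: ell2 and r :: real
  note reps = plus_ell2.rep_eq zero_ell2.rep_eq uminus_ell2.rep_eq minus_ell2.rep_eq
    scaleR_ell2.rep_eq
  have summable_prod: "summable (\<lambda>i. coord u i * coord v i)" for u v
    by (intro summable_mult_of_squares summable_coord_square)
  show "x \<bullet> y = y \<bullet> x"
    by (simp add: inner_ell2_def mult.commute)
  show "(x + y) \<bullet> z = x \<bullet> z + y \<bullet> z"
    by (simp add: inner_ell2_def reps distrib_right suminf_add[OF summable_prod summable_prod])
  show "(r *\<^sub>R x) \<bullet> y = r * (x \<bullet> y)"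
    by (simp add: inner_ell2_def reps mult.assoc suminf_mult[OF summable_prod])
  show "0 \<le> x \<bullet> x"
    unfolding inner_ell2_def by (intro suminf_nonneg summable_prod) simp
  show "x \<bullet> x = 0 \<longleftrightarrow> x = 0"
  proof
    assume "x \<bullet> x = 0"
    then have "\<forall>i. coord x i * coord x i = 0"
      unfolding inner_ell2_def using suminf_eq_zero_iff[OF summable_prod, of x x] by simp
    then show "x = 0" by (intro ell2_eqI) (simp add: reps)
  qed (simp add: inner_ell2_def reps)
  show "norm x = sqrt (x \<bullet> x)" by (rule norm_ell2_def)
  show "sgn x = x /\<^sub>R norm x" by (rule sgn_ell2_def)
  show "dist x y = norm (x - y)" by (rule dist_ell2_def)
qed (fact uniformity_ell2_def open_ell2_def)+
end

lift_definition ell2_trunc :: "nat \<Rightarrow> ell2 \<Rightarrow> ell2" is "\<lambda>n x i. if i < n then x i else 0"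
  subgoal for n x
    by (rule summable_finite[of "{..<n}"]) auto
  done

lemma inner_ell2_trunc: "x \<bullet> ell2_trunc n y = (\<Sum>i<n. coord x i * coord y i)"
  unfolding inner_ell2_def ell2_trunc.rep_eq
  by (subst suminf_finite[of "{..<n}"]) auto

text \<open>The finitely supported sequences are dense.\<close>

lemma ell2_trunc_tendsto: "(\<lambda>n. norm (y - ell2_trunc n y)) \<longlonglongrightarrow> 0"
proof -
  have sq: "(norm (y - ell2_trunc n y))\<^sup>2 = y \<bullet> y - (\<Sum>i<n. (coord y i)\<^sup>2)" for n
  proof -
    have "ell2_trunc n y \<bullet> ell2_trunc n y = y \<bullet> ell2_trunc n y"
      unfolding inner_ell2_trunc by (intro sum.cong) (simp_all add: ell2_trunc.rep_eq)
    moreover have "ell2_trunc n y \<bullet> y = y \<bullet> ell2_trunc n y"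
      by (rule inner_commute)
    ultimately have "(norm (y - ell2_trunc n y))\<^sup>2 = y \<bullet> y - y \<bullet> ell2_trunc n y"
      unfolding power2_norm_eq_inner by (simp add: inner_diff_left inner_diff_right)
    then show ?thesis by (simp add: inner_ell2_trunc power2_eq_square)
  qed
  have "(\<lambda>n. \<Sum>i<n. (coord y i)\<^sup>2) \<longlonglongrightarrow> y \<bullet> y"
    using summable_LIMSEQ[OF summable_coord_square[of y]]
    by (simp add: inner_ell2_def power2_eq_square)
  then have "(\<lambda>n. (norm (y - ell2_trunc n y))\<^sup>2) \<longlonglongrightarrow> y \<bullet> y - y \<bullet> y"
    unfolding sq by (intro tendsto_intros)
  then have "(\<lambda>n. sqrt ((norm (y - ell2_trunc n y))\<^sup>2)) \<longlonglongrightarrow> sqrt 0"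
    by (intro tendsto_real_sqrt) simp
  then show ?thesis by simp
qed

section \<open>Ultrafilters as filters\<close>

text \<open>Regarded as filters, ultrafilters come with a calculus of limits.\<close>

locale ultra =
  fixes F :: "'z filter"
  assumes nontrivial: "F \<noteq> bot"
    and decides: "eventually P F \<or> eventually (\<lambda>z. \<not> P z) F"
begin

text \<open>The limit is the supremum of the numbers that are almost everywhere a lower bound.\<close>

lemma bounded_has_limit:
  fixes \<phi> :: "'z \<Rightarrow> real"
  assumes bd: "\<And>z. \<bar>\<phi> z\<bar> \<le> C"
  obtains L where "(\<phi> \<longlongrightarrow> L) F"
proof -
  define S where "S = {r. eventually (\<lambda>z. r \<le> \<phi> z) F}"
  have "- C \<in> S"
    unfolding S_def using bd by (auto simp: abs_le_iff intro!: always_eventually) (metis minus_le_iff)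
  have ub: "r \<le> C" if "r \<in> S" for r
  proof -
    from that obtain z where "r \<le> \<phi> z"
      unfolding S_def using nontrivial eventually_happens by blast
    also have "\<phi> z \<le> C" using bd[of z] by simp
    finally show ?thesis .
  qed
  have bdd: "bdd_above S" using ub by (rule bdd_aboveI)
  have "(\<phi> \<longlongrightarrow> Sup S) F"
  proof (rule order_tendstoI)
    fix a assume "a < Sup S"
    then obtain r where "r \<in> S" "a < r"
      using less_cSup_iff[OF _ bdd] \<open>- C \<in> S\<close> by auto
    then show "eventually (\<lambda>z. a < \<phi> z) F"
      unfolding S_def by (auto elim: eventually_mono)
  next
    fix a assume "Sup S < a"
    then have "a \<notin> S" using cSup_upper[OF _ bdd] by force
    then have "eventually (\<lambda>z. \<not> a \<le> \<phi> z) F"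
      unfolding S_def using decides by blast
    then show "eventually (\<lambda>z. \<phi> z < a) F" by (simp add: not_le)
  qed
  then show ?thesis by (rule that)
qed

definition weak_limit :: "('z \<Rightarrow> ell2) \<Rightarrow> ell2" where
  "weak_limit u = (THE w. \<forall>y. ((\<lambda>z. u z \<bullet> y) \<longlongrightarrow> w \<bullet> y) F)"

lemma weak_limit_eqI:
  assumes "\<And>y. ((\<lambda>z. u z \<bullet> y) \<longlongrightarrow> w \<bullet> y) F"
  shows "weak_limit u = w"
  unfolding weak_limit_def
proof (rule the_equality)
  fix v assume "\<forall>y. ((\<lambda>z. u z \<bullet> y) \<longlongrightarrow> v \<bullet> y) F"
  then have "v \<bullet> y = w \<bullet> y" for y
    using assms tendsto_unique[OF nontrivial] by blast
  then have "(v - w) \<bullet> (v - w) = 0" by (simp only: inner_diff_left)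
  then show "v = w" by simp
qed (use assms in simp)

text \<open>The weak limit is the coordinatewise limit. Its partial sums of squares are limits of those of
  \<open>u z\<close>, so it is square-summable; and testing against a finitely supported vector involves only
  finitely many coordinates, so that density and boundedness give all other test vectors.\<close>

lemma weak_limit_exists:
  fixes u :: "'z \<Rightarrow> ell2"
  assumes bd: "\<And>z. norm (u z) \<le> C"
  shows "\<exists>w. \<forall>y. ((\<lambda>z. u z \<bullet> y) \<longlongrightarrow> w \<bullet> y) F"
proof -
  have ip_bd: "\<bar>u z \<bullet> y\<bar> \<le> C * norm y" for z y
    using Cauchy_Schwarz_ineq2[of "u z" y] mult_right_mono[OF bd norm_ge_zero[of y], of z] by simp
  have coord_bd: "(\<Sum>i<n. (coord (u z) i)\<^sup>2) \<le> C\<^sup>2" for n z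
  proof -
    have "(\<Sum>i<n. (coord (u z) i)\<^sup>2) \<le> suminf (\<lambda>i. (coord (u z) i)\<^sup>2)"
      by (intro sum_le_suminf summable_coord_square) auto
    also have "\<dots> = (norm (u z))\<^sup>2"
      unfolding power2_norm_eq_inner inner_ell2_def by (simp add: power2_eq_square)
    also have "\<dots> \<le> C\<^sup>2" using bd by (intro power_mono) auto
    finally show ?thesis .
  qed
  have "\<exists>L. ((\<lambda>z. coord (u z) i) \<longlongrightarrow> L) F" for i
  proof -
    have "(coord (u z) i)\<^sup>2 \<le> \<bar>C\<bar>\<^sup>2" for z
      using coord_bd[of z "Suc i"] sum_nonneg[of "{..<i}" "\<lambda>i. (coord (u z) i)\<^sup>2"] by simp
    then have "\<bar>coord (u z) i\<bar> \<le> \<bar>C\<bar>" for z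
      by (simp add: abs_le_square_iff)
    then show ?thesis using bounded_has_limit[of "\<lambda>z. coord (u z) i" "\<bar>C\<bar>"] by blast
  qed
  then obtain l where l: "\<And>i. ((\<lambda>z. coord (u z) i) \<longlongrightarrow> l i) F"
    using choice[of "\<lambda>i L. ((\<lambda>z. coord (u z) i) \<longlongrightarrow> L) F"] by blast
  have "(\<Sum>i<n. (l i)\<^sup>2) \<le> C\<^sup>2" for n
  proof (rule tendsto_upperbound[OF _ _ nontrivial])
    show "((\<lambda>z. \<Sum>i<n. (coord (u z) i)\<^sup>2) \<longlongrightarrow> (\<Sum>i<n. (l i)\<^sup>2)) F"
      by (intro tendsto_intros l)
  qed (simp add: coord_bd)
  then have "summable (\<lambda>i. (l i)\<^sup>2)"
    by (intro bounded_imp_summable[where B = "C\<^sup>2"]) (simp_all del: sum.lessThan_Suc flip: lessThan_Suc_atMost)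
  then obtain w where w: "coord w = l" using Abs_ell2_inverse by blast
  have "((\<lambda>z. u z \<bullet> y) \<longlongrightarrow> w \<bullet> y) F" for y
  proof -
    obtain L where L: "((\<lambda>z. u z \<bullet> y) \<longlongrightarrow> L) F"
      using bounded_has_limit[of "\<lambda>z. u z \<bullet> y" "C * norm y"] ip_bd by blast
    have "\<bar>L - w \<bullet> ell2_trunc n y\<bar> \<le> C * norm (y - ell2_trunc n y)" for n
    proof (rule tendsto_upperbound[OF _ _ nontrivial])
      have "((\<lambda>z. u z \<bullet> ell2_trunc n y) \<longlongrightarrow> w \<bullet> ell2_trunc n y) F"
        unfolding inner_ell2_trunc w by (intro tendsto_intros l)
      then show "((\<lambda>z. \<bar>u z \<bullet> y - u z \<bullet> ell2_trunc n y\<bar>) \<longlongrightarrow> \<bar>L - w \<bullet> ell2_trunc n y\<bar>) F"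
        by (intro tendsto_rabs tendsto_diff L)
      show "\<forall>\<^sub>F z in F. \<bar>u z \<bullet> y - u z \<bullet> ell2_trunc n y\<bar> \<le> C * norm (y - ell2_trunc n y)"
        by (simp add: ip_bd flip: inner_diff_right)
    qed
    moreover have "(\<lambda>n. w \<bullet> ell2_trunc n y) \<longlonglongrightarrow> w \<bullet> y"
      using tendsto_inner[OF tendsto_const tendsto_diff[OF tendsto_const
            tendsto_norm_zero_cancel[OF ell2_trunc_tendsto[of y]]], of w y]
      by simp
    ultimately have "\<bar>L - w \<bullet> y\<bar> \<le> C * 0"
      by (intro tendsto_le[OF sequentially_bot tendsto_mult[OF tendsto_const ell2_trunc_tendsto[of y]]
            tendsto_rabs[OF tendsto_diff[OF tendsto_const]]]) auto
    with L show ?thesis by simp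
  qed
  then show ?thesis by blast
qed

lemma weak_limit:
  fixes u :: "'z \<Rightarrow> ell2"
  assumes "\<And>z. norm (u z) \<le> C"
  shows "((\<lambda>z. u z \<bullet> y) \<longlongrightarrow> weak_limit u \<bullet> y) F"
proof -
  obtain w where w: "\<And>y. ((\<lambda>z. u z \<bullet> y) \<longlongrightarrow> w \<bullet> y) F"
    using weak_limit_exists[of u C] assms by blast
  then show ?thesis using weak_limit_eqI[of u w] by simp
qed

end

section \<open>A van der Corput inequality for idempotent ultrafilters\<close>

text \<open>The characteristic property of \<open>p + p = p\<close>: a sum of two independent generic points is again
  generic.\<close>

locale idempotent_ultra = ultra F for F :: "'z::ab_group_add filter" +
  assumes idem: "eventually P F \<longleftrightarrow> (\<forall>\<^sub>F a in F. \<forall>\<^sub>F b in F. P (a + b))"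
begin

text \<open>The points are the tail sums \<open>a\<^sub>i + \<dots> + a\<^sub>n\<close> of successively chosen generic points. By idempotence
  each of them is generic, and an earlier tail differs from a later one by a generic summand. The
  induction keeps the innermost summand variable: a list \<open>s\<close> is good for almost all translations
  \<open>b\<close>, and the next list consists of \<open>s\<close> translated by one such \<open>b\<close>, and of \<open>0\<close>.\<close>

lemma sorted_list_exists:
  fixes R :: "'z \<Rightarrow> 'z \<Rightarrow> bool"
  assumes Q: "eventually Q F" and R: "\<forall>\<^sub>F a in F. \<forall>\<^sub>F b in F. R b (a + b)"
  shows "\<exists>zs. length zs = n \<and> (\<forall>z\<in>set zs. Q z) \<and> sorted_wrt R zs"
proof -
  define Q' where "Q' a \<longleftrightarrow> Q a \<and> (\<forall>\<^sub>F b in F. R b (a + b))" for a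
  have Q': "eventually Q' F"
    unfolding Q'_def using Q R by (rule eventually_conj)
  define good where
    "good s b \<longleftrightarrow> (\<forall>t\<in>set s. Q' (t + b)) \<and> sorted_wrt (\<lambda>s t. R (s + b) (t + b)) s" for s b
  have "\<exists>s. length s = n \<and> eventually (good s) F"
  proof (induction n)
    case 0
    show ?case by (simp add: good_def)
  next
    case (Suc n)
    then obtain s where s: "length s = n" "eventually (good s) F" by blast
    from s(2) have "\<forall>\<^sub>F b in F. \<forall>\<^sub>F c in F. good s (b + c)" by (simp only: idem[of "good s"])
    with s(2) have "\<forall>\<^sub>F b in F. good s b \<and> (\<forall>\<^sub>F c in F. good s (b + c))"
      by (rule eventually_conj)
    then obtain b where b: "good s b" "\<forall>\<^sub>F c in F. good s (b + c)"
      using nontrivial eventually_happens by blast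
    have "\<forall>\<^sub>F c in F. \<forall>t\<in>set s. R c (t + b + c)"
      using b(1) by (intro eventually_ball_finite) (auto simp: good_def Q'_def)
    then have "\<forall>\<^sub>F c in F. good (0 # map (\<lambda>t. t + b) s) c"
      using b(2) Q'
      by eventually_elim (auto simp: good_def sorted_wrt_map add.assoc)
    then show ?case
      using s(1) by (intro exI[of _ "0 # map (\<lambda>t. t + b) s"]) simp
  qed
  then obtain s where s: "length s = n" "eventually (good s) F" by blast
  from s(2) obtain b where "good s b"
    using nontrivial eventually_happens by blast
  then show ?thesis
    using s(1) by (intro exI[of _ "map (\<lambda>t. t + b) s"]) (auto simp: good_def Q'_def sorted_wrt_map)
qed

text \<open>Choose \<open>N\<close> vectors \<open>u z\<close> that correlate with \<open>w\<close> almost as well as \<open>w\<close> itself and whose mutual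
  inner products are at most \<open>e\<close>. Their mean has inner product about \<open>\<parallel>w\<parallel>\<^sup>2\<close> with \<open>w\<close>, while its squared
  norm is at most about \<open>e\<close>; hence \<open>\<parallel>w\<parallel>\<^sup>2 \<le> e\<close>.\<close>

lemma van_der_Corput:
  fixes u :: "'z \<Rightarrow> ell2"
  assumes bd: "\<And>z. norm (u z) \<le> C"
    and w: "((\<lambda>z. u z \<bullet> w) \<longlongrightarrow> w \<bullet> w) F"
    and e: "0 \<le> e" "\<forall>\<^sub>F a in F. \<forall>\<^sub>F b in F. u b \<bullet> u (a + b) \<le> e"
  shows "w \<bullet> w \<le> e"
proof (rule field_le_epsilon)
  fix \<epsilon> :: real assume "0 < \<epsilon>"
  have norm_sum: "(norm (\<Sum>z\<leftarrow>zs. u z))\<^sup>2 \<le> real (length zs) * C\<^sup>2 + (real (length zs))\<^sup>2 * e"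
    if "sorted_wrt (\<lambda>b c. u b \<bullet> u c \<le> e) zs" for zs
    using that
  proof (induction zs)
    case (Cons z zs)
    let ?S = "\<Sum>z\<leftarrow>zs. u z" and ?n = "real (length zs)"
    have "u z \<bullet> (\<Sum>y\<leftarrow>ys. u y) \<le> real (length ys) * e" if "\<forall>y\<in>set ys. u z \<bullet> u y \<le> e" for ys
      using that by (induction ys) (auto simp: inner_add_right algebra_simps intro: add_mono)
    then have 1: "u z \<bullet> ?S \<le> ?n * e" using Cons.prems by simp
    have 2: "(norm (u z))\<^sup>2 \<le> C\<^sup>2" using bd by (intro power_mono) auto
    have 3: "(norm ?S)\<^sup>2 \<le> ?n * C\<^sup>2 + ?n\<^sup>2 * e" using Cons by simp
    have "(norm (u z + ?S))\<^sup>2 = (norm (u z))\<^sup>2 + 2 * (u z \<bullet> ?S) + (norm ?S)\<^sup>2"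
      by (simp add: power2_norm_eq_inner inner_add_left inner_add_right inner_commute)
    also have "\<dots> \<le> C\<^sup>2 + 2 * (?n * e) + (?n * C\<^sup>2 + ?n\<^sup>2 * e)"
      using 1 2 3 by linarith
    also have "\<dots> \<le> (1 + ?n) * C\<^sup>2 + (1 + ?n)\<^sup>2 * e"
      using e(1) by (simp add: power2_sum algebra_simps)
    finally show ?case by simp
  qed simp
  obtain N :: nat where N: "0 < N" "2 * C\<^sup>2 < real N * \<epsilon>"
  proof -
    obtain N where "2 * C\<^sup>2 / \<epsilon> < real N" using reals_Archimedean2 by blast
    then have "2 * C\<^sup>2 < real N * \<epsilon>" using \<open>0 < \<epsilon>\<close> by (simp add: field_simps)
    moreover from this have "0 < N" using \<open>0 < \<epsilon>\<close> by (cases N) (auto simp: not_less)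
    ultimately show ?thesis using that by blast
  qed
  have "\<forall>\<^sub>F z in F. w \<bullet> w - \<epsilon> / 4 < u z \<bullet> w"
    using w \<open>0 < \<epsilon>\<close> by (intro order_tendstoD) auto
  from sorted_list_exists[OF this e(2), of N]
  obtain zs where zs: "length zs = N" "\<forall>z\<in>set zs. w \<bullet> w - \<epsilon> / 4 < u z \<bullet> w"
    "sorted_wrt (\<lambda>b c. u b \<bullet> u c \<le> e) zs" by blast
  let ?S = "\<Sum>z\<leftarrow>zs. u z"
  have "real (length ys) * (w \<bullet> w - \<epsilon> / 4) \<le> (\<Sum>y\<leftarrow>ys. u y) \<bullet> w"
    if "\<forall>y\<in>set ys. w \<bullet> w - \<epsilon> / 4 < u y \<bullet> w" for ys
    using that by (induction ys) (fastforce simp: inner_add_left distrib_right intro: add_mono)+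
  then have S: "real N * (w \<bullet> w - \<epsilon> / 4) \<le> ?S \<bullet> w" using zs(1,2) by blast
  have "0 \<le> (norm (?S - real N *\<^sub>R w))\<^sup>2" by simp
  also have "\<dots> = (norm ?S)\<^sup>2 - 2 * real N * (?S \<bullet> w) + (real N)\<^sup>2 * (w \<bullet> w)"
    unfolding power2_norm_eq_inner
    by (simp add: inner_diff_left inner_diff_right inner_commute power2_eq_square)
  also have "\<dots> \<le> real N * C\<^sup>2 + (real N)\<^sup>2 * e
      - 2 * real N * (real N * (w \<bullet> w - \<epsilon> / 4)) + (real N)\<^sup>2 * (w \<bullet> w)"
    using norm_sum[OF zs(3)] mult_left_mono[OF S, of "2 * real N"] zs(1) by simp
  also have "\<dots> = real N * (C\<^sup>2 + real N * (e + \<epsilon> / 2 - w \<bullet> w))"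
    by (simp add: power2_eq_square algebra_simps)
  finally have "0 \<le> C\<^sup>2 + real N * (e + \<epsilon> / 2 - w \<bullet> w)"
    using N(1) by (simp add: zero_le_mult_iff)
  then have "0 < real N * (e + \<epsilon> - w \<bullet> w)"
    using N(2) by (simp add: algebra_simps)
  then show "w \<bullet> w \<le> e + \<epsilon>"
    using N(1) by (simp add: zero_less_mult_iff)
qed

end

section \<open>Noetherian abelian groups\<close>

definition subgrp :: "'a::ab_group_add set \<Rightarrow> bool" where
  "subgrp H \<longleftrightarrow> 0 \<in> H \<and> (\<forall>x\<in>H. \<forall>y\<in>H. x - y \<in> H)"

lemma subgrp_uminus: "subgrp H \<Longrightarrow> x \<in> H \<Longrightarrow> - x \<in> H"
  unfolding subgrp_def by (metis diff_0)

lemma subgrp_add: "subgrp H \<Longrightarrow> x \<in> H \<Longrightarrow> y \<in> H \<Longrightarrow> x + y \<in> H"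
  using subgrp_uminus[of H y] unfolding subgrp_def by (metis diff_minus_eq_add)

text \<open>The ascending chain condition for subgroups, as the well-foundedness on which the main induction
  runs.\<close>

definition noetherian :: "'a::ab_group_add set \<Rightarrow> bool" where
  "noetherian G \<longleftrightarrow> wf {(H', H). subgrp H \<and> subgrp H' \<and> H \<subset> H' \<and> H' \<subseteq> G}"

lemma noetherian_mono: "noetherian G \<Longrightarrow> H \<subseteq> G \<Longrightarrow> noetherian H"
  unfolding noetherian_def by (erule wf_subset) auto

lemma noetherian_trivial: "G \<subseteq> {0} \<Longrightarrow> noetherian G"
proof -
  assume "G \<subseteq> {0}"
  then have "{(H', H). subgrp H \<and> subgrp H' \<and> H \<subset> H' \<and> H' \<subseteq> G} = {}"
    by (auto simp: subgrp_def)
  then show ?thesis by (simp only: noetherian_def wf_def) simp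
qed

text \<open>A subgroup that grows must enlarge its image under \<open>\<phi>\<close> or its intersection with the kernel.\<close>

lemma noetherian_hom:
  fixes \<phi> :: "'a::ab_group_add \<Rightarrow> 'b::ab_group_add"
  assumes \<phi>: "\<And>x y. x \<in> G \<Longrightarrow> y \<in> G \<Longrightarrow> \<phi> (x - y) = \<phi> x - \<phi> y"
    and img: "\<phi> ` G \<subseteq> G'" "noetherian G'" and ker: "noetherian {x \<in> G. \<phi> x = 0}"
  shows "noetherian G"
  unfolding noetherian_def
proof (rule wf_subset)
  let ?R = "\<lambda>G. {(H', H). subgrp H \<and> subgrp H' \<and> H \<subset> H' \<and> H' \<subseteq> G}"
  let ?K = "{x \<in> G. \<phi> x = 0}"
  show "wf (inv_image (?R G' <*lex*> ?R ?K) (\<lambda>H. (\<phi> ` H, H \<inter> ?K)))"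
    using img(2) ker unfolding noetherian_def by (intro wf_inv_image wf_lex_prod)
  show "?R G \<subseteq> inv_image (?R G' <*lex*> ?R ?K) (\<lambda>H. (\<phi> ` H, H \<inter> ?K))"
  proof (rule subrelI)
    fix H' H assume "(H', H) \<in> ?R G"
    then have H: "subgrp H" "subgrp H'" "H \<subset> H'" "H' \<subseteq> G" by simp_all
    have sub_img: "subgrp (\<phi> ` L)" if L: "subgrp L" "L \<subseteq> G" for L
      unfolding subgrp_def
    proof (intro conjI ballI)
      have "\<phi> (0 - 0) = \<phi> 0 - \<phi> 0" using L by (intro \<phi>) (auto simp: subgrp_def)
      then show "0 \<in> \<phi> ` L" using L by (auto simp: subgrp_def intro!: image_eqI[of _ _ 0])
      fix x y assume "x \<in> \<phi> ` L" "y \<in> \<phi> ` L"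
      then obtain a b where ab: "a \<in> L" "b \<in> L" "x = \<phi> a" "y = \<phi> b" by blast
      then have "x - y = \<phi> (a - b)" using \<phi>[of a b] L by force
      then show "x - y \<in> \<phi> ` L" using ab L by (auto simp: subgrp_def)
    qed
    have sub_ker: "subgrp (L \<inter> ?K)" if L: "subgrp L" "L \<subseteq> G" for L
      unfolding subgrp_def
    proof (intro conjI ballI)
      have "\<phi> (0 - 0) = \<phi> 0 - \<phi> 0" using L by (intro \<phi>) (auto simp: subgrp_def)
      then show "0 \<in> L \<inter> ?K" using L by (auto simp: subgrp_def)
      fix x y assume "x \<in> L \<inter> ?K" "y \<in> L \<inter> ?K"
      then show "x - y \<in> L \<inter> ?K" using L \<phi>[of x y] by (auto simp: subgrp_def)
    qed
    show "(H', H) \<in> inv_image (?R G' <*lex*> ?R ?K) (\<lambda>H. (\<phi> ` H, H \<inter> ?K))"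
    proof (cases "\<phi> ` H = \<phi> ` H'")
      case False
      then have "\<phi> ` H \<subset> \<phi> ` H'" using H by blast
      then show ?thesis using H img sub_img[of H] sub_img[of H'] by auto
    next
      case True
      from H obtain x where x: "x \<in> H'" "x \<notin> H" by blast
      with True obtain h where h: "h \<in> H" "\<phi> x = \<phi> h" by blast
      have "x - h \<notin> H" using subgrp_add[of H "x - h" h] H(1) h x by auto
      moreover have "x - h \<in> H' \<inter> ?K"
        using \<phi>[of x h] x h H by (simp add: subgrp_def subset_iff psubset_eq)
      ultimately have "H \<inter> ?K \<subset> H' \<inter> ?K" using H by blast
      then show ?thesis using True H sub_ker[of H] sub_ker[of H'] by auto
    qed
  qed
qed

lemma noetherian_homs:
  fixes \<phi> :: "'j \<Rightarrow> 'a::ab_group_add \<Rightarrow> 'b::ab_group_add"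
  assumes "finite J"
    and \<phi>: "\<And>j x y. j \<in> J \<Longrightarrow> x \<in> G \<Longrightarrow> y \<in> G \<Longrightarrow> \<phi> j (x - y) = \<phi> j x - \<phi> j y"
    and img: "\<And>j. j \<in> J \<Longrightarrow> \<phi> j ` G \<subseteq> G'" "noetherian G'"
    and ker: "noetherian {x \<in> G. \<forall>j\<in>J. \<phi> j x = 0}"
  shows "noetherian G"
  using assms(1) \<phi> img(1) ker
proof (induction J arbitrary: G rule: finite_induct)
  case (insert j J)
  have "noetherian {x \<in> G. \<phi> j x = 0}"
  proof (rule insert.IH)
    show "noetherian {x \<in> {x \<in> G. \<phi> j x = 0}. \<forall>i\<in>J. \<phi> i x = 0}"
      using insert.prems(3) by (rule noetherian_mono) auto
    show "\<phi> i ` {x \<in> G. \<phi> j x = 0} \<subseteq> G'" if "i \<in> J" for i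
      using insert.prems(2)[of i] that by auto
  qed (use insert.prems(1) in auto)
  then show ?case
    using insert.prems img(2) by (intro noetherian_hom[of G "\<phi> j" G']) auto
qed simp

text \<open>Among all subgroups of a family with a nonzero element, one that contains the least positive
  integer occurring anywhere is maximal, by division with remainder.\<close>

lemma noetherian_int: "noetherian (UNIV :: int set)"
  unfolding noetherian_def wf_eq_minimal
proof (intro allI impI)
  fix \<Q> :: "int set set" and H0 assume H0: "H0 \<in> \<Q>"
  let ?R = "{(H', H :: int set). subgrp H \<and> subgrp H' \<and> H \<subset> H' \<and> H' \<subseteq> UNIV}"
  show "\<exists>H\<in>\<Q>. \<forall>H'. (H', H) \<in> ?R \<longrightarrow> H' \<notin> \<Q>"
  proof (cases "\<exists>H\<in>\<Q>. subgrp H \<and> \<not> H \<subseteq> {0}")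
    case False
    have "H' \<notin> \<Q>" if "(H', H0) \<in> ?R" for H'
    proof
      assume "H' \<in> \<Q>"
      with that False have "H' \<subseteq> {0}" by blast
      moreover have "0 \<in> H0" "H0 \<subset> H'" using that by (simp_all add: subgrp_def)
      ultimately show False by blast
    qed
    then show ?thesis using H0 by blast
  next
    case True
    let ?P = "\<lambda>n. 0 < n \<and> (\<exists>H\<in>\<Q>. subgrp H \<and> int n \<in> H)"
    from True obtain H x where "H \<in> \<Q>" "subgrp H" "x \<in> H" "x \<noteq> 0" by blast
    then have "?P (nat \<bar>x\<bar>)"
      using subgrp_uminus[of H x] by (auto simp: abs_if intro!: bexI[of _ H])
    then have "?P (LEAST n. ?P n)" by (rule LeastI)
    then obtain n where n: "n = (LEAST n. ?P n)" "?P n" by blast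
    then obtain H where H: "H \<in> \<Q>" "subgrp H" "int n \<in> H" by blast
    have mult: "k * int n \<in> L" if "subgrp L" "int n \<in> L" for k L
    proof (induction k rule: int_induct[where k = 0])
      case base show ?case using that by (simp add: subgrp_def)
    next
      case (step1 i) then show ?case using subgrp_add[OF that(1) step1(2) that(2)]
        by (simp add: distrib_right)
    next
      case (step2 i) then show ?case using that by (simp add: left_diff_distrib subgrp_def)
    qed
    have "H' \<notin> \<Q>" if H': "(H', H) \<in> ?R" for H'
    proof
      assume "H' \<in> \<Q>"
      from H' obtain x where x: "x \<in> H'" "x \<notin> H" by blast
      have "int n \<in> H'" using H' H by blast
      then have "x - (x div int n) * int n \<in> H'"
        using mult[of H' "x div int n"] H' x(1) by (auto simp: subgrp_def)
      then have mod: "x mod int n \<in> H'" by (simp add: minus_div_mult_eq_mod)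
      have "x mod int n \<noteq> 0"
      proof
        assume "x mod int n = 0"
        then have "x = (x div int n) * int n" by (metis add.right_neutral div_mult_mod_eq)
        then show False using mult[OF H(2,3), of "x div int n"] x(2) by simp
      qed
      moreover have "0 \<le> x mod int n" "x mod int n < int n" using n(2) by simp_all
      ultimately have "?P (nat (x mod int n))" "nat (x mod int n) < n"
        using mod \<open>H' \<in> \<Q>\<close> H' by auto
      then show False using not_less_Least[of "nat (x mod int n)" ?P] n(1) by blast
    qed
    then show ?thesis using H by blast
  qed
qed

section \<open>Polynomial maps between abelian groups\<close>

definition defect :: "'z::ab_group_add \<Rightarrow> ('z \<Rightarrow> 'k::ab_group_add) \<Rightarrow> 'z \<Rightarrow> 'k" where
  "defect a g = (\<lambda>b. g (a + b) - g a - g b)"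

text \<open>These are the polynomial maps of degree at most \<open>d\<close> that vanish at the origin; the latter is
  enforced by \<open>defect 0 g 0 = - g 0\<close>.\<close>

primrec polymaps :: "nat \<Rightarrow> ('z::ab_group_add \<Rightarrow> 'k::ab_group_add) set" where
  "polymaps 0 = {0}"
| "polymaps (Suc d) = {g. \<forall>a. defect a g \<in> polymaps d}"

lemma defect_simps:
  "defect a 0 = 0" "defect a (g - h) = defect a g - defect a h"
  by (auto simp: defect_def fun_eq_iff algebra_simps)

lemma polymaps_at_zero: "g \<in> polymaps d \<Longrightarrow> g 0 = 0"
proof (induction d arbitrary: g)
  case (Suc d)
  then have "defect 0 g 0 = 0" by auto
  then show ?case by (simp add: defect_def)
qed simp

lemma subgrp_polymaps: "subgrp (polymaps d)"
  by (induction d) (auto simp: subgrp_def defect_simps)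

lemma polymaps_Suc: "g \<in> polymaps d \<Longrightarrow> g \<in> polymaps (Suc d)"
proof (induction d arbitrary: g)
  case (Suc d)
  then have "\<forall>a. defect a g \<in> polymaps d" by simp
  with Suc.IH have "\<forall>a. defect a g \<in> polymaps (Suc d)" by blast
  then show ?case by (subst polymaps.simps) simp
qed (simp add: defect_simps)

lemma polymaps_mono: "g \<in> polymaps d \<Longrightarrow> d \<le> e \<Longrightarrow> g \<in> polymaps e"
proof -
  assume "g \<in> polymaps d" "d \<le> e"
  from this(2,1) show ?thesis
    by (induction rule: dec_induct) (simp_all only: polymaps_Suc)
qed

lemma polymaps_hom:
  assumes \<phi>: "\<And>x y. \<phi> (x - y) = \<phi> x - \<phi> y" and "g \<in> polymaps d"
  shows "(\<lambda>z. \<phi> (g z)) \<in> polymaps d"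
  using assms(2)
proof (induction d arbitrary: g)
  case 0
  then show ?case using \<phi>[of 0 0] by (auto simp: fun_eq_iff)
next
  case (Suc d)
  have "defect a (\<lambda>z. \<phi> (g z)) = (\<lambda>z. \<phi> (defect a g z))" for a
    by (simp add: defect_def \<phi>)
  then show ?case using Suc by simp
qed

lemma polymaps_sum:
  fixes g :: "'i \<Rightarrow> 'z::ab_group_add \<Rightarrow> 'k::ab_group_add"
  assumes "finite I" "\<And>i. i \<in> I \<Longrightarrow> \<exists>d. g i \<in> polymaps d"
  shows "\<exists>d. (\<lambda>z. \<Sum>i\<in>I. g i z) \<in> polymaps d"
  using assms
proof (induction I rule: finite_induct)
  case empty
  then show ?case by (intro exI[of _ 0]) (simp add: fun_eq_iff)
next
  case (insert i I)
  obtain d where "g i \<in> polymaps d" using insert.prems by blast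
  moreover obtain e where "(\<lambda>z. \<Sum>i\<in>I. g i z) \<in> polymaps e" using insert by blast
  ultimately have "g i \<in> polymaps (max d e)" "(\<lambda>z. \<Sum>i\<in>I. g i z) \<in> polymaps (max d e)"
    by (auto elim: polymaps_mono)
  then have "g i + (\<lambda>z. \<Sum>i\<in>I. g i z) \<in> polymaps (max d e)"
    by (rule subgrp_add[OF subgrp_polymaps])
  then show ?case using insert.hyps by (auto simp: plus_fun_def)
qed

text \<open>The defects at the generators map degree \<open>d + 1\<close> to degree \<open>d\<close>. A map in the kernel of all these
  homomorphisms is additive, hence determined by its values at the generators, which lie in the
  Noetherian group \<open>K\<close>.\<close>

lemma noetherian_polymaps:
  fixes E :: "'z::ab_group_add set" and K :: "'k::ab_group_add set"
  assumes E: "finite E" "\<And>H. subgrp H \<Longrightarrow> E \<subseteq> H \<Longrightarrow> H = UNIV"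
    and K: "subgrp K" "noetherian K"
  shows "noetherian {g :: 'z \<Rightarrow> 'k. g \<in> polymaps d \<and> range g \<subseteq> K}"
proof (induction d)
  case 0
  show ?case by (rule noetherian_trivial) auto
next
  case (Suc d)
  let ?G = "\<lambda>d. {g :: 'z \<Rightarrow> 'k. g \<in> polymaps d \<and> range g \<subseteq> K}"
  show ?case
  proof (rule noetherian_homs[where \<phi> = defect and J = E and G' = "?G d"])
    show "defect e (g - h) = defect e g - defect e h" for e and g h :: "'z \<Rightarrow> 'k"
      by (rule defect_simps)
    show "defect e ` ?G (Suc d) \<subseteq> ?G d" for e
      using K(1) by (auto simp: defect_def subgrp_def image_subset_iff)
    let ?L = "{g \<in> ?G (Suc d). \<forall>e\<in>E. defect e g = 0}"
    show "noetherian ?L"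
    proof (rule noetherian_homs[where \<phi> = "\<lambda>e g. g e" and J = E and G' = K])
      show "noetherian {g \<in> ?L. \<forall>e\<in>E. g e = 0}"
      proof (rule noetherian_trivial, rule subsetI)
        fix g assume g: "g \<in> {g \<in> ?L. \<forall>e\<in>E. g e = 0}"
        have "{a. \<forall>b. g (a + b) = g b} = UNIV"
        proof (rule E(2))
          show "subgrp {a. \<forall>b. g (a + b) = g b}"
            unfolding subgrp_def
          proof (intro conjI ballI)
            fix x y assume xy: "x \<in> {a. \<forall>b. g (a + b) = g b}" "y \<in> {a. \<forall>b. g (a + b) = g b}"
            have "g (x - y + b) = g b" for b
            proof -
              have "g (y + (x - y + b)) = g (x - y + b)" using xy(2) by blast
              moreover have "g (x + b) = g b" using xy(1) by blast
              moreover have "y + (x - y + b) = x + b" by simp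
              ultimately show ?thesis by (simp only:)
            qed
            then show "x - y \<in> {a. \<forall>b. g (a + b) = g b}" by simp
          qed simp
          show "E \<subseteq> {a. \<forall>b. g (a + b) = g b}"
            using g by (auto simp: defect_def fun_eq_iff)
        qed
        then have "g (a + 0) = g 0" for a by blast
        moreover have "g 0 = 0" using g polymaps_at_zero[of g "Suc d"] by blast
        ultimately show "g \<in> {0}" by (simp add: fun_eq_iff)
      qed
    qed (use E(1) K(2) in auto)
  qed (use E(1) Suc in auto)
qed

text \<open>Without the normalization at the origin, constants are included, and polynomial expressions are
  built from constants and coordinates by sums and products. The index is one more than the
  degree.\<close>

primrec diffpolys :: "nat \<Rightarrow> ('z::ab_group_add \<Rightarrow> 'r::ab_group_add) set" where
  "diffpolys 0 = {0}"
| "diffpolys (Suc d) = {g. \<forall>a. (\<lambda>b. g (a + b) - g b) \<in> diffpolys d}"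

lemma subgrp_diffpolys: "subgrp (diffpolys d)"
proof (induction d)
  case (Suc d)
  have "(\<lambda>b. (g - h) (a + b) - (g - h) b) = (\<lambda>b. g (a + b) - g b) - (\<lambda>b. h (a + b) - h b)"
    for a and g h :: "'a \<Rightarrow> 'b"
    by (simp add: fun_eq_iff)
  moreover have "(\<lambda>b. (0 :: 'a \<Rightarrow> 'b) (a + b) - (0 :: 'a \<Rightarrow> 'b) b) = 0" for a
    by (simp add: fun_eq_iff)
  ultimately show ?case using Suc unfolding subgrp_def by simp
qed (simp add: subgrp_def)

lemma diffpolys_Suc: "g \<in> diffpolys d \<Longrightarrow> g \<in> diffpolys (Suc d)"
proof (induction d arbitrary: g)
  case 0
  then show ?case by (simp add: fun_eq_iff)
next
  case (Suc d)
  then have "\<forall>a. (\<lambda>b. g (a + b) - g b) \<in> diffpolys d" by simp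
  with Suc.IH have "\<forall>a. (\<lambda>b. g (a + b) - g b) \<in> diffpolys (Suc d)" by blast
  then show ?case by (subst diffpolys.simps) simp
qed

lemma diffpolys_mono: "g \<in> diffpolys d \<Longrightarrow> d \<le> e \<Longrightarrow> g \<in> diffpolys e"
proof -
  assume "g \<in> diffpolys d" "d \<le> e"
  from this(2,1) show ?thesis
    by (induction rule: dec_induct) (simp_all only: diffpolys_Suc)
qed

lemma diffpolys_const: "(\<lambda>_. c) \<in> diffpolys (Suc 0)"
  by (simp add: fun_eq_iff)

lemma diffpolys_add:
  assumes "g \<in> diffpolys d" "h \<in> diffpolys d"
  shows "(\<lambda>z. g z + h z) \<in> diffpolys d"
  using subgrp_add[OF subgrp_diffpolys assms] by (simp add: plus_fun_def)

text \<open>This is the product rule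
  \<open>\<Delta>(g h) = \<Delta>g \<cdot> h + g \<cdot> \<Delta>h + \<Delta>g \<cdot> \<Delta>h\<close> for differences.\<close>

lemma diffpolys_mult:
  fixes g h :: "'z::ab_group_add \<Rightarrow> 'r::comm_ring"
  assumes "g \<in> diffpolys d" "h \<in> diffpolys e"
  shows "(\<lambda>z. g z * h z) \<in> diffpolys (d + e)"
  using assms
proof (induction "d + e" arbitrary: d e g h rule: less_induct)
  case less
  show ?case
  proof (cases "d = 0 \<or> e = 0")
    case True
    then have "(\<lambda>z. g z * h z) \<in> diffpolys 0"
      using less.prems by (auto simp: fun_eq_iff)
    then show ?thesis by (rule diffpolys_mono) simp
  next
    case False
    then obtain d' e' where de: "d = Suc d'" "e = Suc e'"
      by (metis not0_implies_Suc)
    let ?D = "\<lambda>(g :: 'z \<Rightarrow> 'r) a b. g (a + b) - g b"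
    have "(\<lambda>b. g (a + b) * h (a + b) - g b * h b) \<in> diffpolys (d' + e)" for a
    proof -
      have D: "?D g a \<in> diffpolys d'" "?D h a \<in> diffpolys e'"
        using less.prems de by simp_all
      have "(\<lambda>b. ?D g a b * h b) \<in> diffpolys (d' + e)"
        using D(1) less.prems(2) by (rule less.hyps[rotated]) (simp add: de)
      moreover have "(\<lambda>b. g b * ?D h a b) \<in> diffpolys (d + e')"
        using less.prems(1) D(2) by (rule less.hyps[rotated]) (simp add: de)
      moreover have "(\<lambda>b. ?D g a b * ?D h a b) \<in> diffpolys (d' + e')"
        using D by (rule less.hyps[rotated]) (simp add: de)
      moreover have "d + e' = d' + e" "d' + e' \<le> d' + e" by (simp_all add: de)
      ultimately have "(\<lambda>b. ?D g a b * h b + g b * ?D h a b + ?D g a b * ?D h a b)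
          \<in> diffpolys (d' + e)"
        by (intro diffpolys_add) (auto elim: diffpolys_mono simp only:)
      moreover have "g (a + b) * h (a + b) - g b * h b =
          ?D g a b * h b + g b * ?D h a b + ?D g a b * ?D h a b" for b
        by (simp add: algebra_simps)
      ultimately show ?thesis by simp
    qed
    then show ?thesis using de by simp
  qed
qed

lemma polymaps_of_diffpolys:
  "g \<in> diffpolys d \<Longrightarrow> (\<lambda>z. g z - g 0) \<in> polymaps d"
proof (induction d arbitrary: g)
  case (Suc d)
  have "defect a (\<lambda>z. g z - g 0) \<in> polymaps d" for a
  proof -
    have "(\<lambda>b. (g (a + b) - g b) - (g (a + 0) - g 0)) \<in> polymaps d"
      using Suc.prems by (intro Suc.IH[of "\<lambda>b. g (a + b) - g b"]) simp
    moreover have "defect a (\<lambda>z. g z - g 0) = (\<lambda>b. (g (a + b) - g b) - (g (a + 0) - g 0))"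
      by (simp add: defect_def fun_eq_iff)
    ultimately show ?thesis by (simp only:)
  qed
  then show ?case by simp
qed (simp add: fun_eq_iff)

text \<open>The coefficients of an integer-valued polynomial may be fractions, so the degree is bounded
  over the rationals first.\<close>

lemma diffpolys_of_int_cancel:
  fixes g :: "'z::ab_group_add \<Rightarrow> int"
  assumes "(\<lambda>z. of_int (g z) :: 'r::ring_char_0) \<in> diffpolys d"
  shows "g \<in> diffpolys d"
  using assms
proof (induction d arbitrary: g)
  case (Suc d)
  have "(\<lambda>b. of_int (g (a + b) - g b) :: 'r) \<in> diffpolys d" for a
    using Suc.prems by simp
  then show ?case using Suc.IH by simp
qed (simp add: fun_eq_iff)

definition is_diffpoly :: "('z::ab_group_add \<Rightarrow> 'r::ab_group_add) \<Rightarrow> bool" where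
  "is_diffpoly g \<longleftrightarrow> (\<exists>d. g \<in> diffpolys d)"

lemma is_diffpoly_const: "is_diffpoly (\<lambda>_. c)"
  unfolding is_diffpoly_def using diffpolys_const by blast

lemma is_diffpoly_add:
  assumes "is_diffpoly g" "is_diffpoly h"
  shows "is_diffpoly (\<lambda>z. g z + h z)"
proof -
  from assms obtain d e where "g \<in> diffpolys d" "h \<in> diffpolys e"
    unfolding is_diffpoly_def by blast
  then have "g \<in> diffpolys (max d e)" "h \<in> diffpolys (max d e)"
    by (auto elim: diffpolys_mono)
  then show ?thesis unfolding is_diffpoly_def using diffpolys_add by blast
qed

lemma is_diffpoly_mult:
  fixes g h :: "'z::ab_group_add \<Rightarrow> 'r::comm_ring"
  shows "is_diffpoly g \<Longrightarrow> is_diffpoly h \<Longrightarrow> is_diffpoly (\<lambda>z. g z * h z)"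
  unfolding is_diffpoly_def using diffpolys_mult by blast

lemma is_diffpoly_sum:
  "finite I \<Longrightarrow> (\<And>i. i \<in> I \<Longrightarrow> is_diffpoly (g i)) \<Longrightarrow> is_diffpoly (\<lambda>z. \<Sum>i\<in>I. g i z)"
  by (induction I rule: finite_induct) (simp_all add: is_diffpoly_const is_diffpoly_add)

lemma is_diffpoly_prod:
  fixes g :: "'i \<Rightarrow> 'z::ab_group_add \<Rightarrow> 'r::comm_ring_1"
  shows "finite I \<Longrightarrow> (\<And>i. i \<in> I \<Longrightarrow> is_diffpoly (g i)) \<Longrightarrow> is_diffpoly (\<lambda>z. \<Prod>i\<in>I. g i z)"
  by (induction I rule: finite_induct) (simp_all add: is_diffpoly_const is_diffpoly_mult)

lemma is_diffpoly_power:
  fixes g :: "'z::ab_group_add \<Rightarrow> 'r::comm_ring_1"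
  shows "is_diffpoly g \<Longrightarrow> is_diffpoly (\<lambda>z. g z ^ k)"
  by (induction k) (simp_all add: is_diffpoly_const is_diffpoly_mult)

lemma is_diffpoly_coordinate:
  "is_diffpoly (\<lambda>z :: int ^ 'n. of_int (z $ j) :: 'r::comm_ring_1)"
  unfolding is_diffpoly_def
  by (intro exI[of _ "Suc (Suc 0)"]) (simp add: fun_eq_iff)

lemma int_poly_val_polymap:
  fixes f :: "'n::finite rat_poly"
  assumes "f \<in> int_polys" "poly_val f 0 = 0"
  shows "\<exists>d. int_poly_val f \<in> polymaps d"
proof -
  have "is_diffpoly (poly_val f)"
    unfolding poly_val_def[abs_def]
    by (intro is_diffpoly_sum is_diffpoly_mult is_diffpoly_const is_diffpoly_prod
        is_diffpoly_power is_diffpoly_coordinate finite finite_keys)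
  moreover have "of_int (int_poly_val f z) = poly_val f z" for z
    using assms(1) by (auto simp: int_poly_val_def int_polys_def elim: Ints_cases)
  ultimately obtain d where "(\<lambda>z. of_int (int_poly_val f z) :: rat) \<in> diffpolys d"
    by (auto simp: is_diffpoly_def)
  from polymaps_of_diffpolys[OF diffpolys_of_int_cancel[OF this]]
  have "(\<lambda>z. int_poly_val f z - int_poly_val f 0) \<in> polymaps d" .
  moreover have "int_poly_val f 0 = 0" using assms(2) by (simp add: int_poly_val_def)
  ultimately have "int_poly_val f \<in> polymaps d" by simp
  then show ?thesis ..
qed

lemma generators_int_vec:
  fixes H :: "(int ^ 'n::finite) set"
  assumes H: "subgrp H" "range (\<lambda>j. axis j 1) \<subseteq> H"
  shows "H = UNIV"
proof -
  have mult: "k *s v \<in> H" if "v \<in> H" for k v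
  proof (induction k rule: int_induct[where k = 0])
    case base
    show ?case using H(1) by (simp add: subgrp_def)
  next
    case (step1 i)
    then show ?case using subgrp_add[OF H(1)] that by (simp add: vector_sadd_rdistrib)
  next
    case (step2 i)
    then show ?case using H(1) that by (simp add: vector_ssub_ldistrib vec.scale_left_diff_distrib subgrp_def)
  qed
  have "(\<Sum>j\<in>I. (z $ j) *s axis j 1) \<in> H" if "finite I" for I and z :: "int ^ 'n"
    using that
  proof (induction I rule: finite_induct)
    case empty
    show ?case using H(1) by (simp add: subgrp_def)
  next
    case (insert j I)
    then show ?case using H mult by (auto intro!: subgrp_add)
  qed
  from this[of UNIV] have "z \<in> H" for z by (simp add: basis_expansion)
  then show ?thesis by blast
qed

lemma noetherian_int_tuples: "noetherian {k :: nat \<Rightarrow>\<^sub>0 int. Poly_Mapping.keys k \<subseteq> {1..m}}"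
proof (rule noetherian_homs[where \<phi> = "\<lambda>i k. Poly_Mapping.lookup k i" and J = "{1..m}" and G' = UNIV])
  let ?K = "{k :: nat \<Rightarrow>\<^sub>0 int. Poly_Mapping.keys k \<subseteq> {1..m}}"
  have "k = 0" if "k \<in> ?K" "\<forall>i\<in>{1..m}. Poly_Mapping.lookup k i = 0" for k
  proof (rule poly_mapping_eqI)
    fix i
    show "Poly_Mapping.lookup k i = Poly_Mapping.lookup 0 i"
      using that by (cases "i \<in> {1..m}") (auto simp flip: not_in_keys_iff_lookup_eq_zero)
  qed
  then show "noetherian {k \<in> ?K. \<forall>i\<in>{1..m}. Poly_Mapping.lookup k i = 0}"
    by (intro noetherian_trivial) blast
qed (auto simp: lookup_minus noetherian_int)

lemma subgrp_int_tuples: "subgrp {k :: nat \<Rightarrow>\<^sub>0 int. Poly_Mapping.keys k \<subseteq> I}"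
  unfolding subgrp_def
proof (intro conjI ballI)
  fix k l :: "nat \<Rightarrow>\<^sub>0 int"
  assume "k \<in> {k. Poly_Mapping.keys k \<subseteq> I}" "l \<in> {k. Poly_Mapping.keys k \<subseteq> I}"
  then show "k - l \<in> {k. Poly_Mapping.keys k \<subseteq> I}"
    using keys_diff[of k l] by blast
qed simp

section \<open>Limits of stationary families along polynomial maps\<close>

context idempotent_ultra
begin

text \<open>For idempotent \<open>p\<close> a limit may be computed as an iterated limit over \<open>a + b\<close>.\<close>

lemma iterated_limit:
  fixes \<phi> :: "'z \<Rightarrow> real"
  assumes \<phi>: "(\<phi> \<longlongrightarrow> L) F" and \<psi>: "\<forall>\<^sub>F a in F. ((\<lambda>b. \<phi> (a + b)) \<longlongrightarrow> \<psi> a) F"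
  shows "(\<psi> \<longlongrightarrow> L) F"
proof (rule tendstoI)
  fix e :: real assume "0 < e"
  then have "\<forall>\<^sub>F z in F. dist (\<phi> z) L < e / 2" using \<phi> by (intro tendstoD) auto
  then have "\<forall>\<^sub>F a in F. \<forall>\<^sub>F b in F. dist (\<phi> (a + b)) L < e / 2"
    by (simp only: idem[of "\<lambda>z. dist (\<phi> z) L < e / 2"])
  with \<psi> show "\<forall>\<^sub>F a in F. dist (\<psi> a) L < e"
  proof eventually_elim
    case (elim a)
    have "dist (\<psi> a) L \<le> e / 2"
      by (rule tendsto_upperbound[OF tendsto_dist[OF elim(1) tendsto_const] _ nontrivial])
        (use elim(2) in \<open>rule eventually_mono, simp\<close>)
    then show ?case using \<open>0 < e\<close> by simp
  qed
qed

end

text \<open>If \<open>\<xi> k = U\<^sup>k v\<close> and \<open>\<eta> k = U\<^sup>k w\<close> for a unitary action \<open>U\<close>, then \<open>\<xi>\<close> and \<open>\<eta>\<close> are jointly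
  stationary.\<close>

definition jointly_stationary :: "('k::ab_group_add \<Rightarrow> ell2) \<Rightarrow> ('k \<Rightarrow> ell2) \<Rightarrow> bool" where
  "jointly_stationary \<xi> \<eta> \<longleftrightarrow> (\<forall>j k l. \<xi> (k + j) \<bullet> \<eta> (l + j) = \<xi> k \<bullet> \<eta> l)"

lemma jointly_stationary_sym: "jointly_stationary \<xi> \<eta> \<Longrightarrow> jointly_stationary \<eta> \<xi>"
  by (simp add: jointly_stationary_def inner_commute)

lemma jointly_stationary_add_diff:
  assumes "jointly_stationary \<xi> \<zeta>" "jointly_stationary \<eta> \<zeta>"
  shows "jointly_stationary (\<xi> + \<eta>) \<zeta>" "jointly_stationary (\<xi> - \<eta>) \<zeta>"
  using assms by (simp_all add: jointly_stationary_def inner_add_left inner_diff_left)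

lemma jointly_stationary_norm:
  assumes "jointly_stationary \<xi> \<xi>"
  shows "norm (\<xi> k) = norm (\<xi> 0)"
proof -
  have "\<xi> (0 + k) \<bullet> \<xi> (0 + k) = \<xi> 0 \<bullet> \<xi> 0"
    using assms unfolding jointly_stationary_def by blast
  then show ?thesis by (simp add: norm_eq_sqrt_inner)
qed

locale stationary_family = idempotent_ultra F for F :: "'z::ab_group_add filter" +
  fixes x :: "'k::ab_group_add \<Rightarrow> ell2"
  assumes stationary: "jointly_stationary x x"
begin

text \<open>In terms of the represented vectors this is the weak limit of the operators \<open>U\<^bsup>g(z)\<^esup>\<close>.\<close>

definition lim_op :: "('z \<Rightarrow> 'k) \<Rightarrow> ('k \<Rightarrow> ell2) \<Rightarrow> 'k \<Rightarrow> ell2" where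
  "lim_op g \<xi> = (\<lambda>k. weak_limit (\<lambda>z. \<xi> (k + g z)))"

definition fams_closed :: "('k \<Rightarrow> ell2) set \<Rightarrow> bool" where
  "fams_closed S \<longleftrightarrow> x \<in> S \<and> (\<forall>\<xi>\<in>S. \<forall>\<eta>\<in>S. \<xi> - \<eta> \<in> S) \<and> (\<forall>g. \<forall>\<xi>\<in>S. lim_op g \<xi> \<in> S)"

text \<open>The families obtained from \<open>x\<close> by differences and limit operators; any two of them turn out to be
  jointly stationary, so that they behave as vectors of one unitary representation.\<close>

definition fams :: "('k \<Rightarrow> ell2) set" where
  "fams = \<Inter>{S. fams_closed S}"

lemma fams_closed_fams: "fams_closed fams"
  unfolding fams_def fams_closed_def by blast

lemma fams_base: "x \<in> fams"
  using fams_closed_fams unfolding fams_closed_def by blast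

lemma fams_diff: "\<xi> \<in> fams \<Longrightarrow> \<eta> \<in> fams \<Longrightarrow> \<xi> - \<eta> \<in> fams"
  using fams_closed_fams unfolding fams_closed_def by blast

lemma fams_lim: "\<xi> \<in> fams \<Longrightarrow> lim_op g \<xi> \<in> fams"
  using fams_closed_fams unfolding fams_closed_def by blast

lemma fams_induct [consumes 1, case_names base diff lim]:
  assumes "\<xi> \<in> fams" and "P x"
    and "\<And>\<xi> \<eta>. P \<xi> \<Longrightarrow> P \<eta> \<Longrightarrow> P (\<xi> - \<eta>)"
    and "\<And>\<xi> g. P \<xi> \<Longrightarrow> P (lim_op g \<xi>)"
  shows "P \<xi>"
proof -
  have "fams_closed {\<xi>. P \<xi>}"
    unfolding fams_closed_def using assms(2-4) by blast
  then show ?thesis using assms(1) unfolding fams_def by blast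
qed

lemma lim_op_tendsto_aux:
  assumes "jointly_stationary \<xi> \<xi>"
  shows "((\<lambda>z. \<xi> (k + g z) \<bullet> y) \<longlongrightarrow> lim_op g \<xi> k \<bullet> y) F"
  unfolding lim_op_def
  by (rule weak_limit[where C = "norm (\<xi> 0)"]) (intro eq_refl jointly_stationary_norm[OF assms])

lemma jointly_stationary_lim_op:
  assumes \<xi>: "jointly_stationary \<xi> \<xi>" and \<eta>: "jointly_stationary \<xi> \<eta>"
  shows "jointly_stationary (lim_op g \<xi>) \<eta>"
  unfolding jointly_stationary_def
proof (intro allI)
  fix j k l
  have "((\<lambda>z. \<xi> (k + j + g z) \<bullet> \<eta> (l + j)) \<longlongrightarrow> lim_op g \<xi> (k + j) \<bullet> \<eta> (l + j)) F"
    by (rule lim_op_tendsto_aux[OF \<xi>])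
  moreover have "\<xi> (k + j + g z) \<bullet> \<eta> (l + j) = \<xi> (k + g z) \<bullet> \<eta> l" for z
    using \<eta> unfolding jointly_stationary_def by (metis add.commute add.left_commute)
  ultimately have "((\<lambda>z. \<xi> (k + g z) \<bullet> \<eta> l) \<longlongrightarrow> lim_op g \<xi> (k + j) \<bullet> \<eta> (l + j)) F"
    by simp
  from tendsto_unique[OF nontrivial this lim_op_tendsto_aux[OF \<xi>]]
  show "lim_op g \<xi> (k + j) \<bullet> \<eta> (l + j) = lim_op g \<xi> k \<bullet> \<eta> l" .
qed

text \<open>For a difference to be stationary, its two terms must be jointly stationary. The second conjunct
  supplies this: comparing with \<open>x\<close> is enough to compare with each other.\<close>

lemma fams_stationary_aux:
  assumes "\<xi> \<in> fams"
  shows "jointly_stationary \<xi> \<xi> \<and>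
    (\<forall>\<eta>. jointly_stationary \<eta> \<eta> \<longrightarrow> jointly_stationary x \<eta> \<longrightarrow> jointly_stationary \<xi> \<eta>)"
  using assms
proof (induction rule: fams_induct)
  case base
  show ?case using stationary by blast
next
  case (diff \<xi> \<eta>)
  note sym = jointly_stationary_sym and sub = jointly_stationary_add_diff(2)
  have \<xi>: "jointly_stationary \<xi> \<zeta>" if "jointly_stationary \<zeta> \<zeta>" "jointly_stationary x \<zeta>" for \<zeta>
    using diff(1) that by blast
  have \<eta>: "jointly_stationary \<eta> \<zeta>" if "jointly_stationary \<zeta> \<zeta>" "jointly_stationary x \<zeta>" for \<zeta>
    using diff(2) that by blast
  have self: "jointly_stationary \<xi> \<xi>" "jointly_stationary \<eta> \<eta>" using diff by simp_all
  have "jointly_stationary \<xi> \<eta>"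
    by (rule \<xi>[OF self(2) sym[OF \<eta>[OF stationary stationary]]])
  then have "jointly_stationary \<xi> (\<xi> - \<eta>)" "jointly_stationary \<eta> (\<xi> - \<eta>)"
    using sym[OF sub[OF self(1) sym]] sym[OF sub[OF _ self(2)]] by simp_all
  then have "jointly_stationary (\<xi> - \<eta>) (\<xi> - \<eta>)" by (rule sub)
  moreover have "jointly_stationary (\<xi> - \<eta>) \<zeta>"
    if "jointly_stationary \<zeta> \<zeta>" "jointly_stationary x \<zeta>" for \<zeta>
    by (rule sub[OF \<xi>[OF that] \<eta>[OF that]])
  ultimately show ?case by (intro conjI allI impI)
next
  case (lim \<xi> g)
  then have \<xi>: "jointly_stationary \<xi> \<xi>" by simp
  note step = jointly_stationary_lim_op[OF \<xi>, where g = g]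
  have "jointly_stationary (lim_op g \<xi>) (lim_op g \<xi>)"
    by (rule step[OF jointly_stationary_sym[OF step[OF \<xi>]]])
  then show ?case using lim step by simp
qed

lemma fams_stationary:
  assumes "\<xi> \<in> fams" "\<eta> \<in> fams"
  shows "jointly_stationary \<xi> \<eta>"
proof -
  have "jointly_stationary \<eta> x" using fams_stationary_aux[OF assms(2)] stationary by simp
  from jointly_stationary_sym[OF this] show ?thesis
    using fams_stationary_aux[OF assms(1)] fams_stationary_aux[OF assms(2)] by simp
qed

lemma fams_shift: "\<xi> \<in> fams \<Longrightarrow> \<eta> \<in> fams \<Longrightarrow> \<xi> (k + j) \<bullet> \<eta> (l + j) = \<xi> k \<bullet> \<eta> l"
  using fams_stationary[of \<xi> \<eta>] unfolding jointly_stationary_def by simp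

lemma norm_fams: "\<xi> \<in> fams \<Longrightarrow> norm (\<xi> k) = norm (\<xi> 0)"
  by (intro jointly_stationary_norm fams_stationary)

lemma norm_diff_shift: "\<xi> \<in> fams \<Longrightarrow> norm (\<xi> (k + j) - \<xi> (l + j)) = norm (\<xi> k - \<xi> l)"
  by (simp add: norm_eq_sqrt_inner inner_diff_left inner_diff_right fams_shift)

lemma lim_op_tendsto:
  "\<xi> \<in> fams \<Longrightarrow> ((\<lambda>z. \<xi> (k + g z) \<bullet> y) \<longlongrightarrow> lim_op g \<xi> k \<bullet> y) F"
  by (intro lim_op_tendsto_aux fams_stationary)

lemma lim_op_diff:
  assumes "\<xi> \<in> fams" "\<eta> \<in> fams"
  shows "lim_op g (\<xi> - \<eta>) = lim_op g \<xi> - lim_op g \<eta>"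
proof
  fix k
  have "((\<lambda>z. (\<xi> - \<eta>) (k + g z) \<bullet> y) \<longlongrightarrow> (lim_op g \<xi> k - lim_op g \<eta> k) \<bullet> y) F" for y
    using tendsto_diff[OF lim_op_tendsto[OF assms(1)] lim_op_tendsto[OF assms(2)]]
    by (simp add: inner_diff_left)
  then show "lim_op g (\<xi> - \<eta>) k = (lim_op g \<xi> - lim_op g \<eta>) k"
    unfolding lim_op_def[of g "\<xi> - \<eta>"] by (simp add: weak_limit_eqI)
qed

text \<open>Families are separated by families, because \<open>\<xi> - \<eta>\<close> can be tested against itself.\<close>

lemma fams_eqI:
  assumes "\<xi> \<in> fams" "\<eta> \<in> fams" "\<And>\<zeta> k. \<zeta> \<in> fams \<Longrightarrow> \<xi> k \<bullet> \<zeta> k = \<eta> k \<bullet> \<zeta> k"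
  shows "\<xi> = \<eta>"
proof
  fix k
  have "\<xi> k \<bullet> (\<xi> - \<eta>) k = \<eta> k \<bullet> (\<xi> - \<eta>) k"
    by (intro assms(3) fams_diff assms(1,2))
  then have "(\<xi> k - \<eta> k) \<bullet> (\<xi> k - \<eta> k) = 0"
    by (simp add: inner_diff_left)
  then show "\<xi> k = \<eta> k" by simp
qed

lemma lim_op_adjoint:
  assumes "\<xi> \<in> fams" "\<eta> \<in> fams"
  shows "lim_op g \<xi> k \<bullet> \<eta> l = \<xi> k \<bullet> lim_op (- g) \<eta> l"
proof -
  have "\<eta> (l + (- g) z) \<bullet> \<xi> k = \<xi> (k + g z) \<bullet> \<eta> l" for z
    using fams_shift[OF assms(2,1), of "l - g z" "g z" k] by (simp add: inner_commute)
  then have "((\<lambda>z. \<xi> (k + g z) \<bullet> \<eta> l) \<longlongrightarrow> lim_op (- g) \<eta> l \<bullet> \<xi> k) F"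
    using lim_op_tendsto[OF assms(2), of l "- g" "\<xi> k"] by simp
  from tendsto_unique[OF nontrivial lim_op_tendsto[OF assms(1)] this] show ?thesis
    by (simp add: inner_commute)
qed

text \<open>Moving \<open>h\<close> to the other side of the inner product turns the inner limit into a fixed test vector,
  so the two weak limits never have to be interchanged.\<close>

lemma lim_op_commute:
  assumes "\<xi> \<in> fams"
  shows "lim_op g (lim_op h \<xi>) = lim_op h (lim_op g \<xi>)"
proof (rule fams_eqI)
  fix \<zeta> k assume \<zeta>: "\<zeta> \<in> fams"
  have "((\<lambda>z. lim_op h \<xi> (k + g z) \<bullet> \<zeta> k) \<longlongrightarrow> lim_op g (lim_op h \<xi>) k \<bullet> \<zeta> k) F"
    by (intro lim_op_tendsto fams_lim assms)
  moreover have "((\<lambda>z. \<xi> (k + g z) \<bullet> lim_op (- h) \<zeta> k) \<longlongrightarrow> lim_op g \<xi> k \<bullet> lim_op (- h) \<zeta> k) F"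
    by (intro lim_op_tendsto assms)
  moreover have "lim_op h \<xi> (k + g z) \<bullet> \<zeta> k = \<xi> (k + g z) \<bullet> lim_op (- h) \<zeta> k" for z
    by (rule lim_op_adjoint[OF assms \<zeta>])
  moreover have "lim_op g \<xi> k \<bullet> lim_op (- h) \<zeta> k = lim_op h (lim_op g \<xi>) k \<bullet> \<zeta> k"
    by (rule lim_op_adjoint[symmetric]) (intro fams_lim assms \<zeta>)+
  ultimately show "lim_op g (lim_op h \<xi>) k \<bullet> \<zeta> k = lim_op h (lim_op g \<xi>) k \<bullet> \<zeta> k"
    using tendsto_unique[OF nontrivial] by (simp only:)
qed (intro fams_lim assms)+

lemma norm_lim_op_le:
  assumes "\<xi> \<in> fams"
  shows "norm (lim_op g \<xi> k) \<le> norm (\<xi> k)"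
proof -
  let ?w = "lim_op g \<xi> k"
  have "?w \<bullet> ?w \<le> norm (\<xi> k) * norm ?w"
  proof (rule tendsto_upperbound[OF lim_op_tendsto[OF assms] _ nontrivial])
    show "\<forall>\<^sub>F z in F. \<xi> (k + g z) \<bullet> ?w \<le> norm (\<xi> k) * norm ?w"
      using norm_cauchy_schwarz[of "\<xi> (k + g z)" ?w for z] norm_fams[OF assms]
      by (intro always_eventually) metis
  qed
  then have "norm ?w * norm ?w \<le> norm (\<xi> k) * norm ?w"
    by (simp add: power2_norm_eq_inner flip: power2_eq_square)
  then show ?thesis
    by (metis mult_right_le_imp_le norm_ge_zero norm_le_zero_iff not_le order_trans)
qed

lemma lim_op_zero: "\<xi> \<in> fams \<Longrightarrow> lim_op 0 \<xi> = \<xi>"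
  unfolding lim_op_def by (intro ext weak_limit_eqI) simp

definition is_idem :: "('z \<Rightarrow> 'k) \<Rightarrow> bool" where
  "is_idem g \<longleftrightarrow> (\<forall>\<xi>\<in>fams. lim_op g (lim_op g \<xi>) = lim_op g \<xi>)"

text \<open>For an idempotent contraction \<open>P\<close> and \<open>\<eta> = P \<xi>\<close> we have \<open>\<langle>P\<^sup>* \<eta>, \<eta>\<rangle> = \<langle>\<eta>, P \<eta>\<rangle> = \<parallel>\<eta>\<parallel>\<^sup>2\<close>, so that
  \<open>\<parallel>P\<^sup>* \<eta> - \<eta>\<parallel>\<^sup>2 = \<parallel>P\<^sup>* \<eta>\<parallel>\<^sup>2 - \<parallel>\<eta>\<parallel>\<^sup>2 \<le> 0\<close>. Hence \<open>P\<^sup>* P = P\<close>, and \<open>P\<close> is an orthogonal projection.\<close>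

lemma adjoint_fixes_range:
  assumes g: "is_idem g" and \<xi>: "\<xi> \<in> fams"
  shows "lim_op (- g) (lim_op g \<xi>) = lim_op g \<xi>"
proof
  fix k
  define \<eta> where "\<eta> = lim_op g \<xi>"
  have \<eta>: "\<eta> \<in> fams" "lim_op g \<eta> = \<eta>"
    using g \<xi> by (auto simp: \<eta>_def is_idem_def intro: fams_lim)
  let ?a = "lim_op (- g) \<eta> k"
  have "?a \<bullet> \<eta> k = \<eta> k \<bullet> \<eta> k"
    using lim_op_adjoint[OF \<eta>(1) \<eta>(1), of g k k] \<eta>(2) by (simp add: inner_commute)
  then have "(norm (?a - \<eta> k))\<^sup>2 = (norm ?a)\<^sup>2 - (norm (\<eta> k))\<^sup>2"
    unfolding power2_norm_eq_inner
    by (simp add: inner_diff_left inner_diff_right inner_commute)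
  also have "\<dots> \<le> 0"
    using norm_lim_op_le[OF \<eta>(1), of "- g" k] by (simp add: power_mono)
  finally show "lim_op (- g) (lim_op g \<xi>) k = lim_op g \<xi> k"
    by (simp add: \<eta>_def)
qed

lemma lim_op_inner_self:
  assumes g: "is_idem g" and \<xi>: "\<xi> \<in> fams"
  shows "lim_op g \<xi> k \<bullet> \<xi> k = (norm (lim_op g \<xi> k))\<^sup>2"
  using lim_op_adjoint[OF fams_lim[OF \<xi>, of g] \<xi>, of "- g" k k] adjoint_fixes_range[OF assms]
  by (simp add: power2_norm_eq_inner)

lemma norm_diff_lim_op:
  assumes "is_idem g" "\<xi> \<in> fams"
  shows "(norm ((\<xi> - lim_op g \<xi>) k))\<^sup>2 = (norm (\<xi> k))\<^sup>2 - (norm (lim_op g \<xi> k))\<^sup>2"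
  using lim_op_inner_self[OF assms, of k] unfolding power2_norm_eq_inner
  by (simp add: inner_diff_left inner_diff_right inner_commute)

text \<open>All \<open>\<xi> (k + g z)\<close> have the norm of \<open>\<xi> k\<close>, so weak convergence to \<open>\<xi> k\<close> is convergence in norm.\<close>

lemma tendsto_if_fixed:
  assumes \<xi>: "\<xi> \<in> fams" and fixed: "lim_op g \<xi> = \<xi>"
  shows "((\<lambda>z. \<xi> (k + g z)) \<longlongrightarrow> \<xi> k) F"
proof -
  have eq: "(norm (\<xi> (k + g z) - \<xi> k))\<^sup>2 = 2 * (\<xi> k \<bullet> \<xi> k) - 2 * (\<xi> (k + g z) \<bullet> \<xi> k)" for z
  proof -
    have "\<xi> (k + g z) \<bullet> \<xi> (k + g z) = \<xi> k \<bullet> \<xi> k" using fams_shift[OF \<xi> \<xi>] by blast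
    then show ?thesis
      unfolding power2_norm_eq_inner
      by (simp add: inner_diff_left inner_diff_right inner_commute)
  qed
  have "((\<lambda>z. \<xi> (k + g z) \<bullet> \<xi> k) \<longlongrightarrow> \<xi> k \<bullet> \<xi> k) F"
    using lim_op_tendsto[OF \<xi>, of k g "\<xi> k"] fixed by simp
  then have "((\<lambda>z. (norm (\<xi> (k + g z) - \<xi> k))\<^sup>2) \<longlongrightarrow> 2 * (\<xi> k \<bullet> \<xi> k) - 2 * (\<xi> k \<bullet> \<xi> k)) F"
    unfolding eq by (intro tendsto_diff tendsto_mult tendsto_const)
  then have "((\<lambda>z. sqrt ((norm (\<xi> (k + g z) - \<xi> k))\<^sup>2)) \<longlongrightarrow> sqrt 0) F"
    by (intro tendsto_real_sqrt) simp
  then show ?thesis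
    by (simp add: tendsto_norm_zero_iff LIM_zero_iff)
qed

lemma fixed_if_tendsto:
  assumes "\<And>k. ((\<lambda>z. \<xi> (k + g z)) \<longlongrightarrow> \<xi> k) F"
  shows "lim_op g \<xi> = \<xi>"
  unfolding lim_op_def using assms by (intro ext weak_limit_eqI tendsto_intros)

text \<open>This is where convergence in norm is needed: by translation invariance,
  \<open>\<xi> (k + g z - h z)\<close> is close to \<open>\<xi> (k - h z)\<close>, which is close to \<open>\<xi> k\<close>.\<close>

lemma subgrp_fixing:
  assumes \<xi>: "\<xi> \<in> fams"
  shows "subgrp {g. lim_op g \<xi> = \<xi>}"
  unfolding subgrp_def
proof (intro conjI ballI)
  show "0 \<in> {g. lim_op g \<xi> = \<xi>}" using lim_op_zero[OF \<xi>] by simp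
  fix g h assume "g \<in> {g. lim_op g \<xi> = \<xi>}" "h \<in> {g. lim_op g \<xi> = \<xi>}"
  then have gh: "lim_op g \<xi> = \<xi>" "lim_op h \<xi> = \<xi>" by simp_all
  have "((\<lambda>z. \<xi> (k + (g - h) z)) \<longlongrightarrow> \<xi> k) F" for k
  proof -
    have bound: "((\<lambda>z. norm (\<xi> (k + g z) - \<xi> k) + norm (\<xi> (k + h z) - \<xi> k)) \<longlongrightarrow> 0 + 0) F"
      using tendsto_if_fixed[OF \<xi> gh(1)] tendsto_if_fixed[OF \<xi> gh(2)]
      by (intro tendsto_add) (simp_all add: tendsto_norm_zero_iff LIM_zero_iff)
    have le: "norm (\<xi> (k + (g - h) z) - \<xi> k)
        \<le> norm (\<xi> (k + g z) - \<xi> k) + norm (\<xi> (k + h z) - \<xi> k)" for z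
    proof -
      have "norm (\<xi> (k + g z - h z) - \<xi> (k - h z)) = norm (\<xi> (k + g z) - \<xi> k)"
        using norm_diff_shift[OF \<xi>, of "k + g z" "- h z" k] by simp
      moreover have "norm (\<xi> (k - h z) - \<xi> k) = norm (\<xi> (k + h z) - \<xi> k)"
        using norm_diff_shift[OF \<xi>, of "k - h z" "h z" k] by (simp add: norm_minus_commute)
      ultimately show ?thesis
        using norm_triangle_ineq[of "\<xi> (k + g z - h z) - \<xi> (k - h z)" "\<xi> (k - h z) - \<xi> k"]
        by (simp add: algebra_simps)
    qed
    have "((\<lambda>z. \<xi> (k + (g - h) z) - \<xi> k) \<longlongrightarrow> 0) F"
      by (rule Lim_null_comparison[OF always_eventually[OF allI[OF le]] bound[unfolded add_0]])
    then show ?thesis by (simp only: LIM_zero_iff)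
  qed
  then show "g - h \<in> {g. lim_op g \<xi> = \<xi>}"
    using fixed_if_tendsto[of \<xi> "g - h"] by simp
qed

text \<open>Since \<open>f(a + b) = f(a) + f(b) + D\<^sub>a f(b)\<close> and the last term moves \<open>\<xi>\<close> arbitrarily little, the iterated
  limit of \<open>\<xi> (k + f(a + b))\<close> is that of \<open>\<xi> (k + f(a) + f(b))\<close>.\<close>

lemma idem_if_defects_fixed:
  assumes \<xi>: "\<xi> \<in> fams" and ev: "\<forall>\<^sub>F a in F. lim_op (defect a f) \<xi> = \<xi>"
  shows "lim_op f (lim_op f \<xi>) = lim_op f \<xi>"
  unfolding lim_op_def[of f "lim_op f \<xi>"]
proof (intro ext weak_limit_eqI iterated_limit[OF lim_op_tendsto[OF \<xi>]])
  fix k y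
  from ev show "\<forall>\<^sub>F a in F. ((\<lambda>b. \<xi> (k + f (a + b)) \<bullet> y) \<longlongrightarrow> lim_op f \<xi> (k + f a) \<bullet> y) F"
  proof eventually_elim
    case (elim a)
    have "norm (\<xi> (k + f (a + b)) - \<xi> (k + f a + f b)) = norm (\<xi> (0 + defect a f b) - \<xi> 0)" for b
    proof -
      have "k + f (a + b) = (0 + defect a f b) + (k + f a + f b)"
        by (simp add: defect_def)
      then show ?thesis
        using norm_diff_shift[OF \<xi>, of "0 + defect a f b" "k + f a + f b" 0] by (simp only: add_0)
    qed
    moreover have "((\<lambda>b. norm (\<xi> (0 + defect a f b) - \<xi> 0)) \<longlongrightarrow> 0) F"
      using tendsto_if_fixed[OF \<xi> elim, of 0] by (simp add: tendsto_norm_zero_iff LIM_zero_iff)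
    ultimately have "((\<lambda>b. norm (\<xi> (k + f (a + b)) - \<xi> (k + f a + f b))) \<longlongrightarrow> 0) F"
      by (simp only:)
    from tendsto_inner[OF tendsto_norm_zero_cancel[OF this] tendsto_const[of y]]
    have "((\<lambda>b. (\<xi> (k + f (a + b)) - \<xi> (k + f a + f b)) \<bullet> y) \<longlongrightarrow> 0 \<bullet> y) F" .
    from tendsto_add[OF this lim_op_tendsto[OF \<xi>, of "k + f a" f y]]
    show ?case by (simp add: inner_diff_left)
  qed
qed

text \<open>In the van der Corput inequality for \<open>\<xi> (f z)\<close>, stationarity turns the inner product of the terms
  at \<open>b\<close> and \<open>a + b\<close> into that of \<open>\<xi> 0\<close> and \<open>\<xi> (f(a) + D\<^sub>a f(b))\<close>, whose limit in \<open>b\<close> is controlled by the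
  limit operator of the defect.\<close>

lemma norm_lim_op_le_if_defects_small:
  assumes \<xi>: "\<xi> \<in> fams" and \<epsilon>: "0 \<le> \<epsilon>"
    and ev: "\<forall>\<^sub>F a in F. norm (lim_op (defect a f) \<xi> 0) \<le> \<epsilon>"
  shows "(norm (lim_op f \<xi> 0))\<^sup>2 \<le> norm (\<xi> 0) * \<epsilon>"
proof (rule field_le_epsilon)
  fix \<tau> :: real assume \<tau>: "0 < \<tau>"
  show "(norm (lim_op f \<xi> 0))\<^sup>2 \<le> norm (\<xi> 0) * \<epsilon> + \<tau>"
    unfolding power2_norm_eq_inner
  proof (rule van_der_Corput[where u = "\<lambda>z. \<xi> (0 + f z)" and C = "norm (\<xi> 0)"])
    show "norm (\<xi> (0 + f z)) \<le> norm (\<xi> 0)" for z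
      using norm_fams[OF \<xi>, of "0 + f z"] by simp
    show "((\<lambda>z. \<xi> (0 + f z) \<bullet> lim_op f \<xi> 0) \<longlongrightarrow> lim_op f \<xi> 0 \<bullet> lim_op f \<xi> 0) F"
      by (rule lim_op_tendsto[OF \<xi>])
    show "0 \<le> norm (\<xi> 0) * \<epsilon> + \<tau>" using \<epsilon> \<tau> by simp
    from ev
    show "\<forall>\<^sub>F a in F. \<forall>\<^sub>F b in F. \<xi> (0 + f b) \<bullet> \<xi> (0 + f (a + b)) \<le> norm (\<xi> 0) * \<epsilon> + \<tau>"
    proof eventually_elim
      case (elim a)
      let ?w = "lim_op (defect a f) \<xi> (f a)"
      have "?w \<bullet> \<xi> 0 \<le> norm ?w * norm (\<xi> 0)" by (rule norm_cauchy_schwarz)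
      also have "\<dots> \<le> \<epsilon> * norm (\<xi> 0)"
        using elim norm_fams[OF fams_lim[OF \<xi>], of "defect a f" "f a"]
        by (intro mult_right_mono) auto
      finally have "?w \<bullet> \<xi> 0 < norm (\<xi> 0) * \<epsilon> + \<tau>"
        using \<tau> by (simp add: mult.commute)
      with lim_op_tendsto[OF \<xi>, of "f a" "defect a f" "\<xi> 0"]
      have "\<forall>\<^sub>F b in F. \<xi> (f a + defect a f b) \<bullet> \<xi> 0 < norm (\<xi> 0) * \<epsilon> + \<tau>"
        by (rule order_tendstoD)
      moreover have "\<xi> (0 + f b) \<bullet> \<xi> (0 + f (a + b)) = \<xi> (f a + defect a f b) \<bullet> \<xi> 0" for b
        using fams_shift[OF \<xi> \<xi>, of "f a + defect a f b" "f b" 0]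
        by (simp add: defect_def inner_commute)
      ultimately show ?case by (auto elim: eventually_mono)
    qed
  qed
qed

text \<open>Induction on the degree, and for each degree Noetherian induction on the subgroup \<open>Fix \<xi>\<close>. The
  family \<open>\<delta> \<xi>\<close> measures the failure of idempotence at \<open>\<xi>\<close>; it is linear in \<open>\<xi>\<close>, so components on which it
  vanishes by the induction hypothesis may be subtracted from \<open>\<xi>\<close>.\<close>

lemma is_idem_polymap:
  fixes E :: "'z set" and K :: "'k set"
  assumes E: "finite E" "\<And>H. subgrp H \<Longrightarrow> E \<subseteq> H \<Longrightarrow> H = UNIV"
    and K: "subgrp K" "noetherian K"
    and "f \<in> polymaps d" "range f \<subseteq> K"
  shows "is_idem f"
  using assms(5,6)
proof (induction d arbitrary: f)
  case 0
  then have "f = 0" by simp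
  moreover have "is_idem 0" unfolding is_idem_def
  proof
    fix \<xi> assume "\<xi> \<in> fams"
    then show "lim_op 0 (lim_op 0 \<xi>) = lim_op 0 \<xi>" by (intro lim_op_zero fams_lim)
  qed
  ultimately show ?case by (simp only:)
next
  case (Suc d)
  define G where "G = {g :: 'z \<Rightarrow> 'k. g \<in> polymaps d \<and> range g \<subseteq> K}"
  have defect_G: "defect a f \<in> G" for a
    using Suc.prems K(1) by (auto simp: G_def defect_def subgrp_def image_subset_iff)
  have idem_G: "is_idem g" if "g \<in> G" for g
    using that Suc.IH by (simp add: G_def)
  have sub_G: "subgrp G"
    using subgrp_polymaps[of d] K(1) by (auto simp: G_def subgrp_def image_subset_iff)
  define Fix where "Fix \<xi> = {g \<in> G. lim_op g \<xi> = \<xi>}" for \<xi>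
  have sub_Fix: "subgrp (Fix \<xi>)" if "\<xi> \<in> fams" for \<xi>
    using sub_G subgrp_fixing[OF that] by (auto simp: Fix_def subgrp_def)
  define \<delta> where "\<delta> \<xi> = lim_op f (lim_op f \<xi>) - lim_op f \<xi>" for \<xi>
  let ?R = "{(H', H). subgrp H \<and> subgrp H' \<and> H \<subset> H' \<and> H' \<subseteq> G}"
  have wf: "wf ?R"
    using noetherian_polymaps[OF E K] by (simp add: noetherian_def G_def)
  have "\<delta> \<xi> = 0" if "\<xi> \<in> fams" "Fix \<xi> = H" for \<xi> H
    using wf that
  proof (induction H arbitrary: \<xi> rule: wf_induct_rule)
    case (less H)
    note \<xi> = \<open>\<xi> \<in> fams\<close>
    have larger: "\<delta> \<eta> = 0" if "\<eta> \<in> fams" "Fix \<xi> \<subset> Fix \<eta>" for \<eta>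
      using less.IH[of "Fix \<eta>" \<eta>] less.prems that sub_Fix by (auto simp: Fix_def)
    from decides[of "\<lambda>a. defect a f \<in> Fix \<xi>"] show ?case
    proof
      assume "\<forall>\<^sub>F a in F. defect a f \<in> Fix \<xi>"
      then have "\<forall>\<^sub>F a in F. lim_op (defect a f) \<xi> = \<xi>"
        by (rule eventually_mono) (simp add: Fix_def)
      from idem_if_defects_fixed[OF \<xi> this] show ?thesis by (simp add: \<delta>_def)
    next
      assume ev: "\<forall>\<^sub>F a in F. defect a f \<notin> Fix \<xi>"
      \<comment> \<open>The remainders: still fixed by \<open>Fix \<xi>\<close>, and as far from idempotence as \<open>\<xi>\<close>.\<close>
      define N where "N = {\<eta> \<in> fams. Fix \<xi> \<subseteq> Fix \<eta> \<and> \<delta> \<eta> = \<delta> \<xi> \<and> norm (\<eta> 0) \<le> norm (\<xi> 0)}"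
      have step: "\<eta> - lim_op g \<eta> \<in> N" if \<eta>: "\<eta> \<in> N" and g: "g \<in> G" "g \<notin> Fix \<xi>" for \<eta> g
      proof -
        have \<eta>F: "\<eta> \<in> fams" "lim_op g \<eta> \<in> fams" using \<eta> by (auto simp: N_def intro: fams_lim)
        have gg: "lim_op g (lim_op g \<eta>) = lim_op g \<eta>"
          using idem_G[OF g(1)] \<eta>F by (simp add: is_idem_def)
        have fixed: "lim_op h \<eta> = \<eta>" "lim_op h (lim_op g \<eta>) = lim_op g \<eta>" if "h \<in> Fix \<xi>" for h
          using that \<eta> lim_op_commute[OF \<eta>F(1), of h g] by (auto simp: N_def Fix_def)
        have "Fix \<xi> \<subseteq> Fix (\<eta> - lim_op g \<eta>)"
          using fixed lim_op_diff[OF \<eta>F] by (auto simp: Fix_def)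
        moreover have "\<delta> (\<eta> - lim_op g \<eta>) = \<delta> \<xi>"
        proof -
          have "Fix \<xi> \<subset> Fix (lim_op g \<eta>)"
            using fixed(2) gg g by (auto simp: Fix_def)
          then have "\<delta> (lim_op g \<eta>) = 0" using larger \<eta>F by blast
          moreover have "\<delta> (\<eta> - lim_op g \<eta>) = \<delta> \<eta> - \<delta> (lim_op g \<eta>)"
            using \<eta>F by (simp add: \<delta>_def lim_op_diff fams_lim)
          ultimately show ?thesis using \<eta> by (simp add: N_def)
        qed
        moreover have "norm ((\<eta> - lim_op g \<eta>) 0) \<le> norm (\<xi> 0)"
        proof -
          have "(norm ((\<eta> - lim_op g \<eta>) 0))\<^sup>2 \<le> (norm (\<eta> 0))\<^sup>2"
            using norm_diff_lim_op[OF idem_G[OF g(1)] \<eta>F(1), of 0] by simp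
          then have "norm ((\<eta> - lim_op g \<eta>) 0) \<le> norm (\<eta> 0)"
            by (rule power2_le_imp_le) simp
          then show ?thesis using \<eta> by (simp add: N_def)
        qed
        ultimately show ?thesis using \<eta>F by (simp add: N_def fams_diff)
      qed
      have "(norm (\<delta> \<xi> 0))\<^sup>2 \<le> 4 * (norm (\<xi> 0) * \<epsilon>)" if \<epsilon>: "0 < \<epsilon>" for \<epsilon>
      proof -
        let ?S = "(\<lambda>\<eta>. (norm (\<eta> 0))\<^sup>2) ` N"
        have "\<xi> \<in> N" using \<xi> by (simp add: N_def)
        moreover have bdd: "bdd_below ?S" by (rule bdd_belowI[of _ 0]) auto
        ultimately have "\<exists>s\<in>?S. s < Inf ?S + \<epsilon>\<^sup>2"
          using \<epsilon> by (subst cInf_less_iff[symmetric]) auto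
        \<comment> \<open>No further step can decrease the squared norm of \<open>\<eta>\<close> by \<open>\<epsilon>\<^sup>2\<close> or more.\<close>
        then obtain \<eta> where \<eta>: "\<eta> \<in> N" "(norm (\<eta> 0))\<^sup>2 < Inf ?S + \<epsilon>\<^sup>2" by blast
        have \<eta>F: "\<eta> \<in> fams" "\<delta> \<eta> = \<delta> \<xi>" "norm (\<eta> 0) \<le> norm (\<xi> 0)"
          using \<eta> by (auto simp: N_def)
        have small: "norm (lim_op g \<eta> 0) \<le> \<epsilon>" if g: "g \<in> G" "g \<notin> Fix \<xi>" for g
        proof -
          have "Inf ?S \<le> (norm ((\<eta> - lim_op g \<eta>) 0))\<^sup>2"
            by (intro cInf_lower bdd image_eqI[OF refl] step[OF \<eta>(1) g])
          then have "(norm (lim_op g \<eta> 0))\<^sup>2 \<le> \<epsilon>\<^sup>2"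
            using norm_diff_lim_op[OF idem_G[OF g(1)] \<eta>F(1), of 0] \<eta>(2) by simp
          then show ?thesis by (rule power2_le_imp_le) (use \<epsilon> in simp)
        qed
        have "\<forall>\<^sub>F a in F. norm (lim_op (defect a f) \<eta> 0) \<le> \<epsilon>"
          using ev by (rule eventually_mono) (intro small defect_G)
        then have "(norm (lim_op f \<eta> 0))\<^sup>2 \<le> norm (\<eta> 0) * \<epsilon>"
          using \<epsilon> by (intro norm_lim_op_le_if_defects_small \<eta>F) auto
        also have "\<dots> \<le> norm (\<xi> 0) * \<epsilon>" using \<eta>F(3) \<epsilon> by simp
        finally have le: "(norm (lim_op f \<eta> 0))\<^sup>2 \<le> norm (\<xi> 0) * \<epsilon>" .
        have "norm (\<delta> \<eta> 0) \<le> norm (lim_op f (lim_op f \<eta>) 0) + norm (lim_op f \<eta> 0)"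
          unfolding \<delta>_def by (simp add: norm_triangle_ineq4)
        also have "\<dots> \<le> 2 * norm (lim_op f \<eta> 0)"
          using norm_lim_op_le[OF fams_lim[OF \<eta>F(1)], of f f 0] by simp
        finally have "(norm (\<delta> \<eta> 0))\<^sup>2 \<le> (2 * norm (lim_op f \<eta> 0))\<^sup>2"
          by (intro power_mono) auto
        with le show ?thesis by (simp add: \<eta>F(2) power_mult_distrib)
      qed
      note bound = this
      have "(norm (\<delta> \<xi> 0))\<^sup>2 \<le> 0"
      proof (rule field_le_epsilon)
        fix \<tau> :: real assume \<tau>: "0 < \<tau>"
        let ?n = "norm (\<xi> 0)"
        have "4 * (?n * (\<tau> / (4 * (?n + 1)))) = (4 * ?n * \<tau>) / (4 * (?n + 1))" by simp
        also have "\<dots> \<le> \<tau>"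
        proof (subst pos_divide_le_eq)
          show "0 < 4 * (?n + 1)" by (simp add: add_nonneg_pos)
        qed (use \<tau> in \<open>simp add: algebra_simps\<close>)
        finally have "4 * (?n * (\<tau> / (4 * (?n + 1)))) \<le> \<tau>" .
        moreover have "0 < \<tau> / (4 * (?n + 1))"
          using \<tau> by (simp add: add_nonneg_pos)
        ultimately show "(norm (\<delta> \<xi> 0))\<^sup>2 \<le> 0 + \<tau>"
          using bound[of "\<tau> / (4 * (?n + 1))"] by linarith
      qed
      then have "norm (\<delta> \<xi> 0) = 0" by simp
      moreover have "\<delta> \<xi> \<in> fams"
        unfolding \<delta>_def by (intro fams_diff fams_lim \<xi>)
      ultimately have "norm (\<delta> \<xi> k) = 0" for k using norm_fams by metis
      then show ?thesis by (simp add: fun_eq_iff)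
    qed
  qed
  then show ?case by (simp add: is_idem_def \<delta>_def)
qed

lemma limit_nonneg:
  assumes f: "is_idem f" and L: "((\<lambda>z. x (f z) \<bullet> x 0) \<longlongrightarrow> L) F"
  shows "0 \<le> L"
proof -
  have "((\<lambda>z. x (f z) \<bullet> x 0) \<longlongrightarrow> lim_op f x 0 \<bullet> x 0) F"
    using lim_op_tendsto[OF fams_base, of 0 f "x 0"] by simp
  then have "L = lim_op f x 0 \<bullet> x 0" using L tendsto_unique[OF nontrivial] by blast
  then show ?thesis using lim_op_inner_self[OF f fams_base, of 0] by simp
qed

end

section \<open>Realising correlations by vectors\<close>

context finite_measure
begin

definition bounded_fun :: "('a \<Rightarrow> real) \<Rightarrow> bool" where
  "bounded_fun h \<longleftrightarrow> h \<in> borel_measurable M \<and> (\<exists>C. \<forall>x\<in>space M. \<bar>h x\<bar> \<le> C)"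

definition corr :: "('a \<Rightarrow> real) \<Rightarrow> ('a \<Rightarrow> real) \<Rightarrow> real" where
  "corr g h = (\<integral>x. g x * h x \<partial>M)"

lemma integrable_bounded_mult:
  assumes "bounded_fun g" "bounded_fun h"
  shows "integrable M (\<lambda>x. g x * h x)"
proof -
  obtain C D where C: "\<And>x. x \<in> space M \<Longrightarrow> \<bar>g x\<bar> \<le> C" and D: "\<And>x. x \<in> space M \<Longrightarrow> \<bar>h x\<bar> \<le> D"
    using assms unfolding bounded_fun_def by blast
  show ?thesis
  proof (rule integrable_const_bound[where B = "C * D"])
    have "\<bar>g x * h x\<bar> \<le> C * D" if "x \<in> space M" for x
      unfolding abs_mult using C[OF that] D[OF that] by (intro mult_mono) auto
    then show "AE x in M. norm (g x * h x) \<le> C * D" by (intro AE_I2) simp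
    show "(\<lambda>x. g x * h x) \<in> borel_measurable M"
      using assms by (auto simp: bounded_fun_def)
  qed
qed

lemma bounded_fun_diff_scaled:
  assumes "bounded_fun g" "bounded_fun h"
  shows "bounded_fun (\<lambda>x. g x - c * h x)"
proof -
  obtain C D where C: "\<And>x. x \<in> space M \<Longrightarrow> \<bar>g x\<bar> \<le> C" and D: "\<And>x. x \<in> space M \<Longrightarrow> \<bar>h x\<bar> \<le> D"
    using assms unfolding bounded_fun_def by blast
  have "\<bar>g x - c * h x\<bar> \<le> C + \<bar>c\<bar> * D" if "x \<in> space M" for x
  proof -
    have "\<bar>g x - c * h x\<bar> \<le> \<bar>g x\<bar> + \<bar>c\<bar> * \<bar>h x\<bar>"
      using abs_triangle_ineq4[of "g x" "c * h x"] by (simp add: abs_mult)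
    also have "\<dots> \<le> C + \<bar>c\<bar> * D"
      using C[OF that] D[OF that] by (intro add_mono mult_left_mono) auto
    finally show ?thesis .
  qed
  moreover have "(\<lambda>x. g x - c * h x) \<in> borel_measurable M"
    using assms by (auto simp: bounded_fun_def)
  ultimately show ?thesis unfolding bounded_fun_def by blast
qed

lemma corr_commute: "corr g h = corr h g"
  by (simp add: corr_def mult.commute)

lemma corr_diff_scaled:
  assumes "bounded_fun g" "bounded_fun h" "bounded_fun e"
  shows "corr (\<lambda>x. g x - c * h x) e = corr g e - c * corr h e"
proof -
  have "corr (\<lambda>x. g x - c * h x) e = (\<integral>x. g x * e x - c * (h x * e x) \<partial>M)"
    by (simp add: corr_def algebra_simps)
  also have "\<dots> = (\<integral>x. g x * e x \<partial>M) - (\<integral>x. c * (h x * e x) \<partial>M)"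
    by (intro Bochner_Integration.integral_diff integrable_bounded_mult integrable_mult_right assms)
  finally show ?thesis by (simp add: corr_def)
qed

lemma corr_self_nonneg: "0 \<le> corr g g"
  unfolding corr_def by (rule integral_nonneg_AE) simp

lemma corr_eq_0:
  assumes "bounded_fun g" "bounded_fun h" "corr g g = 0"
  shows "corr g h = 0"
proof -
  have "AE x in M. g x * g x = 0"
    using assms(3) integrable_bounded_mult[OF assms(1,1)] unfolding corr_def
    by (subst (asm) integral_nonneg_eq_0_iff_AE) auto
  then have "AE x in M. g x * h x = 0" by eventually_elim simp
  then show ?thesis unfolding corr_def by (rule integral_eq_zero_AE)
qed

text \<open>Gram-Schmidt orthogonalization on functions: step \<open>n\<close> subtracts from all functions their component
  along the current \<open>n\<close>-th residual. If that residual is null, the quotient is \<open>x / 0 = 0\<close> and nothing is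
  subtracted.\<close>

primrec residual :: "(nat \<Rightarrow> 'a \<Rightarrow> real) \<Rightarrow> nat \<Rightarrow> nat \<Rightarrow> 'a \<Rightarrow> real" where
  "residual w 0 = w"
| "residual w (Suc n) = (\<lambda>i x. residual w n i x
     - corr (residual w n i) (residual w n n) / corr (residual w n n) (residual w n n)
       * residual w n n x)"

definition gram_coord :: "(nat \<Rightarrow> 'a \<Rightarrow> real) \<Rightarrow> nat \<Rightarrow> nat \<Rightarrow> real" where
  "gram_coord w i n =
     corr (residual w n i) (residual w n n) / sqrt (corr (residual w n n) (residual w n n))"

text \<open>Step \<open>n\<close> lowers the correlation of the residuals of \<open>i\<close> and \<open>j\<close> by the product of their \<open>n\<close>-th
  coordinates, and the residual of \<open>i\<close> is null after step \<open>i\<close>. Hence the original correlation is the sum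
  of these products, and \<open>i\<close> has no nonzero coordinate beyond the \<open>i\<close>-th.\<close>

lemma gram_realization_nat:
  fixes w :: "nat \<Rightarrow> 'a \<Rightarrow> real"
  assumes w: "\<And>i. bounded_fun (w i)"
  shows "\<exists>u :: nat \<Rightarrow> ell2. \<forall>i j. u i \<bullet> u j = corr (w i) (w j)"
proof -
  let ?r = "residual w" and ?v = "gram_coord w"
  have bd: "bounded_fun (?r n i)" for n i
    by (induction n arbitrary: i) (simp_all only: residual.simps w bounded_fun_diff_scaled)
  have step: "corr (?r (Suc n) i) (?r (Suc n) j) = corr (?r n i) (?r n j) - ?v i n * ?v j n"
    for n i j
  proof -
    let ?D = "corr (?r n n) (?r n n)"
    let ?a = "corr (?r n i) (?r n n)" and ?b = "corr (?r n j) (?r n n)"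
    have "corr (?r (Suc n) i) (?r (Suc n) j)
        = corr (?r n i) (?r (Suc n) j) - ?a / ?D * corr (?r n n) (?r (Suc n) j)"
      unfolding residual.simps(2)[of w n]
      by (rule corr_diff_scaled) (intro bd bounded_fun_diff_scaled)+
    moreover have "corr (?r n k) (?r (Suc n) j) = corr (?r n k) (?r n j) - ?b / ?D * corr (?r n k) (?r n n)"
      for k
      unfolding residual.simps(2)[of w n]
      by (subst (1 2 5) corr_commute) (rule corr_diff_scaled, (intro bd)+)
    ultimately have "corr (?r (Suc n) i) (?r (Suc n) j) = corr (?r n i) (?r n j) - ?b / ?D * ?a
        - ?a / ?D * (corr (?r n n) (?r n j) - ?b / ?D * ?D)" by simp
    also have "corr (?r n n) (?r n j) = ?b" by (rule corr_commute)
    also have "corr (?r n i) (?r n j) - ?b / ?D * ?a - ?a / ?D * (?b - ?b / ?D * ?D)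
        = corr (?r n i) (?r n j) - ?a * ?b / ?D"
      by (cases "?D = 0") simp_all
    also have "?a * ?b / ?D = ?v i n * ?v j n"
      using corr_self_nonneg[of "?r n n"] by (simp add: gram_coord_def flip: real_sqrt_mult)
    finally show ?thesis .
  qed
  have null: "corr (?r n i) (?r n i) = 0" if "i < n" for n i
    using that
  proof (induction n)
    case (Suc n)
    show ?case
    proof (cases "i = n")
      case False
      then have "corr (?r (Suc n) i) (?r (Suc n) i) \<le> 0"
        using Suc unfolding step by simp
      then show ?thesis using corr_self_nonneg[of "?r (Suc n) i"] by simp
    next
      case True
      then show ?thesis unfolding step using corr_self_nonneg[of "?r n n"]
        by (simp add: gram_coord_def real_div_sqrt)
    qed
  qed simp
  have zero: "?v i n = 0" if "i < n" for i n
    using corr_eq_0[OF bd bd null[OF that], of n n] by (simp add: gram_coord_def)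
  have expand: "corr (w i) (w j) = (\<Sum>n<N. ?v i n * ?v j n) + corr (?r N i) (?r N j)" for i j N
    by (induction N) (simp_all add: step del: residual.simps(2))
  have "summable (\<lambda>n. (?v i n)\<^sup>2)" for i
    by (rule summable_finite[of "{..i}"]) (auto simp: zero)
  then have coord: "coord (Abs_ell2 (?v i)) = ?v i" for i
    by (simp add: Abs_ell2_inverse)
  have "Abs_ell2 (?v i) \<bullet> Abs_ell2 (?v j) = corr (w i) (w j)" for i j
  proof -
    have "Abs_ell2 (?v i) \<bullet> Abs_ell2 (?v j) = (\<Sum>n<Suc i. ?v i n * ?v j n)"
      unfolding inner_ell2_def coord by (rule suminf_finite) (auto simp: zero)
    also have "\<dots> = corr (w i) (w j)"
      using expand[of i j "Suc i"] corr_eq_0[OF bd bd null[of i "Suc i"]]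
      by (simp del: residual.simps sum.lessThan_Suc)
    finally show ?thesis .
  qed
  then show ?thesis by (intro exI[of _ "\<lambda>i. Abs_ell2 (?v i)"]) simp
qed

lemma gram_realization:
  fixes w :: "'k \<Rightarrow> 'a \<Rightarrow> real" and code :: "'k \<Rightarrow> nat"
  assumes "inj code" "\<And>k. bounded_fun (w k)"
  shows "\<exists>u :: 'k \<Rightarrow> ell2. \<forall>k l. u k \<bullet> u l = corr (w k) (w l)"
proof -
  obtain v :: "nat \<Rightarrow> ell2" where v: "\<And>i j. v i \<bullet> v j = corr (w (inv code i)) (w (inv code j))"
    using gram_realization_nat[of "\<lambda>i. w (inv code i)"] assms(2) by blast
  have "v (code k) \<bullet> v (code l) = corr (w k) (w l)" for k l
    unfolding v using assms(1) by simp
  then show ?thesis by (intro exI[of _ "\<lambda>k. v (code k)"]) simp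
qed

end

lemma inj_code_poly_mapping:
  "inj (\<lambda>k :: nat \<Rightarrow>\<^sub>0 'b::{zero,countable}.
     to_nat (map (Poly_Mapping.lookup k) [0..<Poly_Mapping.degree k]))"
proof (rule injI)
  fix k l :: "nat \<Rightarrow>\<^sub>0 'b"
  let ?c = "\<lambda>k :: nat \<Rightarrow>\<^sub>0 'b. map (Poly_Mapping.lookup k) [0..<Poly_Mapping.degree k]"
  assume "to_nat (?c k) = to_nat (?c l)"
  then have "Poly_Mapping.nth (?c k) = Poly_Mapping.nth (?c l)" by simp
  then show "k = l" by (simp only: nth_idem)
qed

section \<open>Actions by commuting invertible transformations\<close>

definition preserves :: "'a measure \<Rightarrow> ('a \<Rightarrow> 'a) \<Rightarrow> bool" where
  "preserves M h \<longleftrightarrow> h \<in> measurable M M \<and> (\<forall>B\<in>sets M. emeasure M (h -` B \<inter> space M) = emeasure M B)"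

lemma preserves_space: "preserves M h \<Longrightarrow> x \<in> space M \<Longrightarrow> h x \<in> space M"
  unfolding preserves_def by (meson measurable_space)

lemma preserves_id: "preserves M id"
  by (simp add: preserves_def)

lemma preserves_comp:
  assumes "preserves M g" "preserves M h"
  shows "preserves M (g \<circ> h)"
  unfolding preserves_def
proof (intro conjI ballI)
  show "g \<circ> h \<in> measurable M M"
    using assms unfolding preserves_def by (blast intro: measurable_comp)
  fix B assume B: "B \<in> sets M"
  have "g -` B \<inter> space M \<in> sets M"
    using assms(1) B unfolding preserves_def by (blast intro: measurable_sets)
  moreover have "(g \<circ> h) -` B \<inter> space M = h -` (g -` B \<inter> space M) \<inter> space M"
    using preserves_space[OF assms(2)] by auto
  ultimately show "emeasure M ((g \<circ> h) -` B \<inter> space M) = emeasure M B"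
    using assms B unfolding preserves_def by (simp only:)
qed

lemma preserves_funpow: "preserves M h \<Longrightarrow> preserves M (h ^^ n)"
  by (induction n) (simp_all add: preserves_id preserves_comp del: id_apply)

lemma integral_preserves:
  fixes g :: "'a \<Rightarrow> real"
  assumes h: "preserves M h" and g: "g \<in> borel_measurable M"
  shows "(\<integral>x. g (h x) \<partial>M) = (\<integral>x. g x \<partial>M)"
proof -
  have "distr M M h = M"
    using h by (intro measure_eqI) (auto simp: preserves_def emeasure_distr)
  moreover have "(\<integral>x. g x \<partial>distr M M h) = (\<integral>x. g (h x) \<partial>M)"
    using h g by (intro integral_distr) (simp_all add: preserves_def)
  ultimately show ?thesis by simp
qed

lemma invertible_mpt_preserves: "invertible_mpt M T \<Longrightarrow> preserves M T"
  by (simp add: invertible_mpt_def preserves_def)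

lemma invertible_mpt_inverse:
  assumes T: "invertible_mpt M T" and x: "x \<in> space M"
  shows "T (inv_into (space M) T x) = x" "inv_into (space M) T (T x) = x"
    "inv_into (space M) T x \<in> space M"
proof -
  have bij: "bij_betw T (space M) (space M)" using T by (simp add: invertible_mpt_def)
  show "T (inv_into (space M) T x) = x" using bij x by (simp add: bij_betw_inv_into_right)
  show "inv_into (space M) T (T x) = x" using bij x by (simp add: bij_betw_inv_into_left)
  show "inv_into (space M) T x \<in> space M"
    using bij x by (metis bij_betw_imp_surj_on inv_into_into)
qed

lemma preserves_inverse:
  assumes T: "invertible_mpt M T"
  shows "preserves M (inv_into (space M) T)"
  unfolding preserves_def
proof (intro conjI ballI)
  let ?I = "inv_into (space M) T"
  show meas: "?I \<in> measurable M M" using T by (simp add: invertible_mpt_def)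
  fix B assume B: "B \<in> sets M"
  then have "?I -` B \<inter> space M \<in> sets M" using meas by (rule measurable_sets[rotated])
  then have "emeasure M (?I -` B \<inter> space M) = emeasure M (T -` (?I -` B \<inter> space M) \<inter> space M)"
    using T unfolding invertible_mpt_def by (simp only:)
  also have "T -` (?I -` B \<inter> space M) \<inter> space M = B"
    using sets.sets_into_space[OF B] invertible_mpt_inverse[OF T]
      preserves_space[OF invertible_mpt_preserves[OF T]] by auto
  finally show "emeasure M (?I -` B \<inter> space M) = emeasure M B" .
qed

lemma preserves_trans_power: "invertible_mpt M T \<Longrightarrow> preserves M (trans_power M T k)"
  by (simp add: trans_power_def preserves_funpow preserves_inverse invertible_mpt_preserves)

lemma trans_power_0: "trans_power M T 0 = id"
  by (simp add: trans_power_def)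

lemma trans_power_succ:
  assumes T: "invertible_mpt M T" and x: "x \<in> space M"
  shows "trans_power M T (k + 1) x = T (trans_power M T k x)"
proof (cases "0 \<le> k")
  case True
  then have "nat (k + 1) = Suc (nat k)" by simp
  then show ?thesis using True by (simp add: trans_power_def)
next
  case False
  let ?I = "inv_into (space M) T"
  define j where "j = nat (- (k + 1))"
  have "nat (- k) = Suc j" using False by (simp add: j_def)
  then have "T (trans_power M T k x) = T (?I ((?I ^^ j) x))"
    using False by (simp add: trans_power_def)
  also have "\<dots> = (?I ^^ j) x"
    using invertible_mpt_inverse(1)[OF T] x
      preserves_space[OF preserves_funpow[OF preserves_inverse[OF T]]] by blast
  also have "\<dots> = trans_power M T (k + 1) x"
    using False by (cases "k = - 1") (simp_all add: trans_power_def j_def)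
  finally show ?thesis ..
qed

lemma trans_power_pred:
  assumes T: "invertible_mpt M T" and x: "x \<in> space M"
  shows "trans_power M T (k - 1) x = inv_into (space M) T (trans_power M T k x)"
  using trans_power_succ[OF assms, of "k - 1"]
    invertible_mpt_inverse(2)[OF T preserves_space[OF preserves_trans_power[OF T] x], of "k - 1"]
  by simp

lemma trans_power_add:
  assumes T: "invertible_mpt M T" and x: "x \<in> space M"
  shows "trans_power M T (k + l) x = trans_power M T k (trans_power M T l x)"
proof (induction k rule: int_induct[where k = 0])
  case base
  show ?case by (simp add: trans_power_0)
next
  case (step1 k)
  then show ?case
    using trans_power_succ[OF T x, of "k + l"]
      trans_power_succ[OF T preserves_space[OF preserves_trans_power[OF T] x], of k l]
    by (simp add: algebra_simps)
next
  case (step2 k)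
  then show ?case
    using trans_power_pred[OF T x, of "k + l"]
      trans_power_pred[OF T preserves_space[OF preserves_trans_power[OF T] x], of k l]
    by (simp add: algebra_simps)
qed

lemma commute_trans_power:
  assumes T: "invertible_mpt M T" and h: "\<And>x. x \<in> space M \<Longrightarrow> h x \<in> space M"
    and comm: "\<And>x. x \<in> space M \<Longrightarrow> h (T x) = T (h x)" and x: "x \<in> space M"
  shows "h (trans_power M T k x) = trans_power M T k (h x)"
proof (induction k rule: int_induct[where k = 0])
  case base
  show ?case by (simp add: trans_power_0)
next
  case (step1 k)
  then show ?case
    using comm[OF preserves_space[OF preserves_trans_power[OF T] x]]
    by (simp add: trans_power_succ[OF T] x h)
next
  case (step2 k)
  let ?I = "inv_into (space M) T"
  have "h (?I y) = ?I (h y)" if y: "y \<in> space M" for y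
  proof -
    have "?I (h (T (?I y))) = ?I (T (h (?I y)))"
      using comm[OF invertible_mpt_inverse(3)[OF T y]] by simp
    then show ?thesis using y h by (simp add: invertible_mpt_inverse[OF T])
  qed
  then show ?case
    using step2 preserves_space[OF preserves_trans_power[OF T] x]
    by (simp add: trans_power_pred[OF T] x h)
qed

lemma foldr_comp_append: "foldr (\<circ>) (hs @ [h]) id = foldr (\<circ>) hs id \<circ> h"
  by (induction hs) (simp_all add: comp_assoc)

lemma trans_prod_0: "trans_prod M T 0 k = id"
  by (simp add: trans_prod_def)

lemma trans_prod_Suc:
  "trans_prod M T (Suc m) k = trans_prod M T m k \<circ> trans_power M (T (Suc m)) (k (Suc m))"
  unfolding trans_prod_def by (simp flip: foldr_comp_append)

lemma trans_prod_cong: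
  "(\<And>i. i \<in> {1..m} \<Longrightarrow> k i = l i) \<Longrightarrow> trans_prod M T m k = trans_prod M T m l"
  by (induction m) (simp_all add: trans_prod_0 trans_prod_Suc)

lemma trans_prod_zero: "trans_prod M T m (\<lambda>_. 0) = id"
  by (induction m) (simp_all add: trans_prod_0 trans_prod_Suc trans_power_0)

lemma preserves_trans_prod:
  "(\<And>i. i \<in> {1..m} \<Longrightarrow> invertible_mpt M (T i)) \<Longrightarrow> preserves M (trans_prod M T m k)"
  by (induction m)
    (simp_all add: trans_prod_0 trans_prod_Suc preserves_id preserves_comp preserves_trans_power del: id_apply)

lemma commute_trans_prod:
  assumes T: "\<And>i. i \<in> {1..m} \<Longrightarrow> invertible_mpt M (T i)"
    and h: "\<And>x. x \<in> space M \<Longrightarrow> h x \<in> space M"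
    and comm: "\<And>i x. i \<in> {1..m} \<Longrightarrow> x \<in> space M \<Longrightarrow> h (T i x) = T i (h x)" and x: "x \<in> space M"
  shows "h (trans_prod M T m k x) = trans_prod M T m k (h x)"
  using T comm x
proof (induction m arbitrary: x)
  case (Suc m)
  let ?S = "trans_power M (T (Suc m)) (k (Suc m))"
  have "h (trans_prod M T m k (?S x)) = trans_prod M T m k (h (?S x))"
    using Suc.prems preserves_space[OF preserves_trans_power[of M "T (Suc m)"]]
    by (intro Suc.IH) auto
  also have "h (?S x) = ?S (h x)"
    using Suc.prems by (intro commute_trans_power[where T = "T (Suc m)"] h) auto
  finally show ?case by (simp add: trans_prod_Suc)
qed (simp add: trans_prod_0)

text \<open>Splitting off the last transformation, its power with exponent \<open>k\<close> has to be moved past the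
  product of the other ones with exponents \<open>l\<close>.\<close>

lemma trans_prod_add:
  assumes T: "\<And>i. i \<in> {1..m} \<Longrightarrow> invertible_mpt M (T i)"
    and comm: "\<And>i j x. i \<in> {1..m} \<Longrightarrow> j \<in> {1..m} \<Longrightarrow> x \<in> space M \<Longrightarrow> T i (T j x) = T j (T i x)"
    and x: "x \<in> space M"
  shows "trans_prod M T m (\<lambda>i. k i + l i) x = trans_prod M T m k (trans_prod M T m l x)"
  using assms
proof (induction m arbitrary: x)
  case (Suc m)
  let ?V = "\<lambda>k. trans_prod M T m k" and ?S = "trans_power M (T (Suc m))"
  have Tm: "invertible_mpt M (T i)" if "i \<in> {1..m}" for i using Suc.prems(1) that by simp
  have T': "invertible_mpt M (T (Suc m))" using Suc.prems(1) by simp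
  have S: "?S a y \<in> space M" if "y \<in> space M" for a y
    using preserves_space[OF preserves_trans_power[OF T'] that] .
  have V: "?V a y \<in> space M" if "y \<in> space M" for a y
    using preserves_space[OF preserves_trans_prod that] Tm by blast
  have swap: "?S a (?V l y) = ?V l (?S a y)" if y: "y \<in> space M" for a y
  proof (rule commute_trans_power[OF T' V _ y, symmetric])
    fix z assume z: "z \<in> space M"
    show "?V l (T (Suc m) z) = T (Suc m) (?V l z)"
      using Suc.prems(2) preserves_space[OF invertible_mpt_preserves[OF T']] z
      by (intro commute_trans_prod[symmetric] Tm) auto
  qed
  have "trans_prod M T (Suc m) (\<lambda>i. k i + l i) x
      = ?V (\<lambda>i. k i + l i) (?S (k (Suc m)) (?S (l (Suc m)) x))"
    using Suc.prems(3) by (simp add: trans_prod_Suc trans_power_add[OF T'])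
  also have "\<dots> = ?V k (?V l (?S (k (Suc m)) (?S (l (Suc m)) x)))"
    using Suc.prems by (intro Suc.IH Tm S) auto
  also have "\<dots> = ?V k (?S (k (Suc m)) (?V l (?S (l (Suc m)) x)))"
    by (simp add: swap S Suc.prems(3))
  finally show ?case by (simp add: trans_prod_Suc)
qed (simp add: trans_prod_0)

section \<open>Polynomial recurrence along an idempotent ultrafilter\<close>

locale commuting_mpts = prob_space M for M :: "'a measure" +
  fixes T :: "nat \<Rightarrow> 'a \<Rightarrow> 'a" and m :: nat
  assumes mpt: "\<And>i. i \<in> {1..m} \<Longrightarrow> invertible_mpt M (T i)"
    and commuting: "\<And>i j x. i \<in> {1..m} \<Longrightarrow> j \<in> {1..m} \<Longrightarrow> x \<in> space M \<Longrightarrow>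
      T i (T j x) = T j (T i x)"
begin

text \<open>The exponents are finitely supported functions, as these form a countable abelian group; only
  the indices \<open>1, \<dots>, m\<close> matter.\<close>

definition act :: "(nat \<Rightarrow>\<^sub>0 int) \<Rightarrow> 'a \<Rightarrow> 'a" where
  "act k = trans_prod M T m (Poly_Mapping.lookup k)"

lemma preserves_act: "preserves M (act k)"
  unfolding act_def using mpt by (rule preserves_trans_prod)

lemma act_add: "x \<in> space M \<Longrightarrow> act (k + l) x = act k (act l x)"
  unfolding act_def lookup_add[abs_def] using mpt commuting by (rule trans_prod_add)

lemma act_zero: "act 0 = id"
proof -
  have "act 0 = trans_prod M T m (\<lambda>_. 0)"
    unfolding act_def by (rule trans_prod_cong) simp
  then show ?thesis by (simp only: trans_prod_zero)
qed

definition centred :: "'a set \<Rightarrow> (nat \<Rightarrow>\<^sub>0 int) \<Rightarrow> 'a \<Rightarrow> real" where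
  "centred A k x = indicator A (act k x) - prob A"

lemma centred_add: "x \<in> space M \<Longrightarrow> centred A (k + l) x = centred A k (act l x)"
  by (simp add: centred_def act_add)

lemma measurable_centred:
  assumes [measurable]: "A \<in> sets M"
  shows "centred A k \<in> borel_measurable M"
proof -
  have [measurable]: "act k \<in> measurable M M" using preserves_act by (simp add: preserves_def)
  show ?thesis unfolding centred_def[abs_def] by measurable
qed

lemma bounded_centred: "A \<in> sets M \<Longrightarrow> bounded_fun (centred A k)"
  unfolding bounded_fun_def
proof (intro conjI exI ballI measurable_centred)
  fix x
  show "\<bar>centred A k x\<bar> \<le> 1 + prob A"
    by (simp add: centred_def indicator_def abs_le_iff measure_nonneg add_nonneg_nonneg)
qed

lemma corr_centred_shift:
  assumes A: "A \<in> sets M"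
  shows "corr (centred A (k + j)) (centred A (l + j)) = corr (centred A k) (centred A l)"
proof -
  have "corr (centred A (k + j)) (centred A (l + j))
      = (\<integral>x. centred A k (act j x) * centred A l (act j x) \<partial>M)"
    unfolding corr_def by (intro Bochner_Integration.integral_cong) (simp_all add: centred_add)
  also have "\<dots> = corr (centred A k) (centred A l)"
    unfolding corr_def
    by (rule integral_preserves[OF preserves_act, where g = "\<lambda>x. centred A k x * centred A l x"])
      (intro borel_measurable_times measurable_centred A)
  finally show ?thesis .
qed

text \<open>Centring the indicator makes the bound \<open>\<mu>(A)\<^sup>2\<close> appear as a subtracted constant.\<close>

lemma corr_centred_zero:
  assumes A: "A \<in> sets M"
  shows "corr (centred A k) (centred A 0) = prob (A \<inter> (act k -` A \<inter> space M)) - (prob A)\<^sup>2"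
proof -
  let ?B = "act k -` A \<inter> space M"
  have B: "?B \<in> sets M" "prob ?B = prob A"
    using preserves_act[of k] A unfolding preserves_def measure_def by (auto intro: measurable_sets)
  have "corr (centred A k) (centred A 0) = (\<integral>x. indicator (A \<inter> ?B) x - prob A * indicator A x
      - prob A * indicator ?B x + prob A * prob A \<partial>M)"
    unfolding corr_def
    by (intro Bochner_Integration.integral_cong refl)
      (auto simp: centred_def act_zero indicator_def algebra_simps)
  also have "\<dots> = prob (A \<inter> ?B) - prob A * prob A - prob A * prob ?B + prob A * prob A"
    using A B(1)
    by (simp add: Bochner_Integration.integral_diff Bochner_Integration.integral_add
        prob_space integrable_real_indicator emeasure_finite less_top[symmetric])
  finally show ?thesis by (simp add: B(2) power2_eq_square)
qed

text \<open>The integer polynomials are the coordinates of one polynomial map \<open>g\<close> into the group of exponents,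
  to which \<open>is_idem_polymap\<close> applies.\<close>

lemma polynomial_recurrence:
  fixes f :: "nat \<Rightarrow> 'n::finite rat_poly" and F :: "(int ^ 'n) filter"
  assumes A: "A \<in> sets M" and F: "idempotent_ultra F"
    and f: "\<And>i. i \<in> {1..m} \<Longrightarrow> f i \<in> int_polys" "\<And>i. i \<in> {1..m} \<Longrightarrow> poly_val (f i) 0 = 0"
    and L: "((\<lambda>z. prob (A \<inter> (trans_prod M T m (\<lambda>i. int_poly_val (f i) z) -` A \<inter> space M)))
      \<longlongrightarrow> L) F"
  shows "(prob A)\<^sup>2 \<le> L"
proof -
  define g where "g z = (\<Sum>i\<in>{1..m}. Poly_Mapping.single i (int_poly_val (f i) z))" for z
  let ?K = "{k :: nat \<Rightarrow>\<^sub>0 int. Poly_Mapping.keys k \<subseteq> {1..m}}"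
  have "\<exists>d. (\<lambda>z. Poly_Mapping.single i (int_poly_val (f i) z)) \<in> polymaps d"
    if i: "i \<in> {1..m}" for i
  proof -
    obtain d where d: "int_poly_val (f i) \<in> polymaps d"
      using int_poly_val_polymap[OF f(1)[OF i] f(2)[OF i]] by blast
    have "(\<lambda>z. Poly_Mapping.single i (int_poly_val (f i) z)) \<in> polymaps d"
      using single_diff d by (rule polymaps_hom)
    then show ?thesis ..
  qed
  then obtain d where g_poly: "g \<in> polymaps d"
    using polymaps_sum[of "{1..m}" "\<lambda>i z. Poly_Mapping.single i (int_poly_val (f i) z)"]
    unfolding g_def[abs_def] by blast
  have g_lookup: "Poly_Mapping.lookup (g z) i = (if i \<in> {1..m} then int_poly_val (f i) z else 0)" for z i
    by (simp add: g_def lookup_sum lookup_single when_def)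
  have g_K: "range g \<subseteq> ?K"
    by (auto simp: in_keys_iff g_lookup split: if_splits)
  have act_g: "act (g z) = trans_prod M T m (\<lambda>i. int_poly_val (f i) z)" for z
    unfolding act_def by (rule trans_prod_cong) (simp add: g_lookup)
  obtain u :: "(nat \<Rightarrow>\<^sub>0 int) \<Rightarrow> ell2" where u: "\<And>k l. u k \<bullet> u l = corr (centred A k) (centred A l)"
    using gram_realization[where w = "centred A", OF inj_code_poly_mapping bounded_centred[OF A]] by blast
  interpret idempotent_ultra F by (rule F)
  interpret stationary_family F u
    by unfold_locales (simp add: jointly_stationary_def u corr_centred_shift[OF A])
  have "is_idem g"
    using finite_imageI[OF finite[of UNIV], of "\<lambda>j. axis j 1"] generators_int_vec subgrp_int_tuples noetherian_int_tuples g_poly g_K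
    by (rule is_idem_polymap)
  moreover have "((\<lambda>z. u (g z) \<bullet> u 0) \<longlongrightarrow> L - (prob A)\<^sup>2) F"
    unfolding u corr_centred_zero[OF A] act_g by (intro tendsto_diff L tendsto_const)
  ultimately have "0 \<le> L - (prob A)\<^sup>2" by (rule limit_nonneg)
  then show ?thesis by simp
qed

end

section \<open>Ultrafilters as collections of sets\<close>

definition uf_filter :: "'s set \<Rightarrow> 's set set \<Rightarrow> 's filter" where
  "uf_filter S p = Abs_filter (\<lambda>P. {s \<in> S. P s} \<in> p)"

context
  fixes S :: "'s set" and p :: "'s set set"
  assumes p: "p \<in> ultrafilters S"
begin

lemma uf_top: "S \<in> p"
  using p by (simp add: ultrafilters_def ultrafilter_on_def)

lemma uf_empty: "{} \<notin> p"
  using p by (simp add: ultrafilters_def ultrafilter_on_def)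

lemma uf_mono: "B \<in> p \<Longrightarrow> B \<subseteq> C \<Longrightarrow> C \<subseteq> S \<Longrightarrow> C \<in> p"
  using p unfolding ultrafilters_def ultrafilter_on_def mem_Collect_eq by meson

lemma uf_int: "B \<in> p \<Longrightarrow> C \<in> p \<Longrightarrow> B \<inter> C \<in> p"
  using p by (simp add: ultrafilters_def ultrafilter_on_def)

lemma uf_decides: "B \<subseteq> S \<Longrightarrow> B \<in> p \<or> S - B \<in> p"
  using p by (simp add: ultrafilters_def ultrafilter_on_def)

lemma eventually_uf_filter: "eventually P (uf_filter S p) \<longleftrightarrow> {s \<in> S. P s} \<in> p"
  unfolding uf_filter_def
proof (rule eventually_Abs_filter, rule is_filter.intro)
  show "{s \<in> S. True} \<in> p" using uf_top by simp
  show "{s \<in> S. P s \<and> Q s} \<in> p" if "{s \<in> S. P s} \<in> p" "{s \<in> S. Q s} \<in> p" for P Q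
    using uf_int[OF that] by (rule back_subst[where P = "\<lambda>B. B \<in> p"]) auto
  show "{s \<in> S. Q s} \<in> p" if "\<forall>s. P s \<longrightarrow> Q s" "{s \<in> S. P s} \<in> p" for P Q
    using that by (intro uf_mono[OF that(2)]) auto
qed

lemma ultra_uf_filter: "ultra (uf_filter S p)"
proof
  show "uf_filter S p \<noteq> bot"
    using uf_empty by (simp add: trivial_limit_def eventually_uf_filter)
  fix P
  have "S - {s \<in> S. P s} = {s \<in> S. \<not> P s}" by auto
  then show "eventually P (uf_filter S p) \<or> (\<forall>\<^sub>F s in uf_filter S p. \<not> P s)"
    using uf_decides[of "{s \<in> S. P s}"] by (auto simp: eventually_uf_filter)
qed

lemma tendsto_uf_filter:
  assumes "has_uf_lim S p \<phi> L"
  shows "(\<phi> \<longlongrightarrow> L) (uf_filter S p)"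
proof (rule topological_tendstoI)
  fix U assume "open U" "L \<in> U"
  then show "\<forall>\<^sub>F s in uf_filter S p. \<phi> s \<in> U"
    using assms by (simp add: has_uf_lim_def eventually_uf_filter interior_open)
qed

lemma eventually_uf_filter_idem:
  assumes "uf_idempotent S opr p" "\<And>s t. s \<in> S \<Longrightarrow> t \<in> S \<Longrightarrow> opr s t \<in> S"
  shows "eventually P (uf_filter S p) \<longleftrightarrow>
    (\<forall>\<^sub>F s in uf_filter S p. \<forall>\<^sub>F t in uf_filter S p. P (opr s t))"
proof -
  have "{s \<in> S. P s} \<in> p \<longleftrightarrow> {s \<in> S. P s} \<in> uf_prod S opr p p"
    using assms(1) by (simp add: uf_idempotent_def)
  also have "\<dots> \<longleftrightarrow> {s \<in> S. {t \<in> S. opr s t \<in> {s \<in> S. P s}} \<in> p} \<in> p"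
    by (simp add: uf_prod_def)
  also have "{s \<in> S. {t \<in> S. opr s t \<in> {s \<in> S. P s}} \<in> p} = {s \<in> S. {t \<in> S. P (opr s t)} \<in> p}"
  proof (rule Collect_cong, rule conj_cong[OF refl])
    fix s assume "s \<in> S"
    then have "{t \<in> S. opr s t \<in> {s \<in> S. P s}} = {t \<in> S. P (opr s t)}"
      using assms(2) by auto
    then show "({t \<in> S. opr s t \<in> {s \<in> S. P s}} \<in> p) = ({t \<in> S. P (opr s t)} \<in> p)" by simp
  qed
  finally show ?thesis by (simp add: eventually_uf_filter)
qed

end

lemma idempotent_ultra_uf_filter:
  fixes p :: "'z::ab_group_add set set"
  assumes "p \<in> ultrafilters UNIV" "uf_idempotent UNIV (+) p"
  shows "idempotent_ultra (uf_filter UNIV p)"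
proof -
  interpret ultra "uf_filter UNIV p" by (rule ultra_uf_filter[OF assms(1)])
  show ?thesis
    by unfold_locales (rule eventually_uf_filter_idem[OF assms], simp)
qed

text \<open>An uncongested ultrafilter avoids each finite set of points, so almost all \<open>\<beta>\<close> are disjoint from \<open>\<alpha>\<close>
  and the image of \<open>\<alpha> \<union> \<beta>\<close> is the sum of the images.\<close>

lemma idempotent_ultra_filtermap_ip:
  fixes w :: "'n::finite \<Rightarrow> nat set \<Rightarrow> nat"
  assumes q: "q \<in> ultrafilters fin_sets" "uncongested q" "uf_idempotent fin_sets (\<union>) q"
    and w: "\<And>j. ip_set (w j)"
  shows "idempotent_ultra (filtermap (\<lambda>\<alpha>. \<chi> j. int (w j \<alpha>)) (uf_filter fin_sets q))"
proof -
  let ?Q = "uf_filter fin_sets q" and ?W = "\<lambda>\<alpha>. \<chi> j. int (w j \<alpha>)"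
  interpret Q: ultra ?Q by (rule ultra_uf_filter[OF q(1)])
  have in_fin: "\<forall>\<^sub>F \<alpha> in ?Q. \<alpha> \<in> fin_sets"
    using uf_top[OF q(1)] by (simp add: eventually_uf_filter[OF q(1)])
  have disjoint: "\<forall>\<^sub>F \<beta> in ?Q. \<alpha> \<inter> \<beta> = {}" if \<alpha>: "\<alpha> \<in> fin_sets" for \<alpha>
  proof -
    have "\<forall>\<^sub>F \<beta> in ?Q. n \<notin> \<beta>" for n
      using Q.decides[of "\<lambda>\<beta>. n \<in> \<beta>"] q(2)
      by (auto simp: eventually_uf_filter[OF q(1)] uncongested_def)
    then have "\<forall>\<^sub>F \<beta> in ?Q. \<forall>n\<in>\<alpha>. n \<notin> \<beta>"
      using \<alpha> by (intro eventually_ball_finite) (auto simp: fin_sets_def)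
    then show ?thesis by (rule eventually_mono) auto
  qed
  have additive: "?W (\<alpha> \<union> \<beta>) = ?W \<alpha> + ?W \<beta>"
    if "\<alpha> \<in> fin_sets" "\<beta> \<in> fin_sets" "\<alpha> \<inter> \<beta> = {}" for \<alpha> \<beta>
  proof -
    have "w j (\<alpha> \<union> \<beta>) = w j \<alpha> + w j \<beta>" for j
    proof -
      obtain x where x: "\<And>\<alpha>. \<alpha> \<in> fin_sets \<Longrightarrow> w j \<alpha> = (\<Sum>i\<in>\<alpha>. x i)"
        using w[of j] unfolding ip_set_def by blast
      have "\<alpha> \<union> \<beta> \<in> fin_sets" using that by (simp add: fin_sets_def)
      then show ?thesis
        using that by (simp add: x sum.union_disjoint fin_sets_def)
    qed
    then show ?thesis by (simp add: vec_eq_iff)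
  qed
  show ?thesis
  proof
    show "filtermap ?W ?Q \<noteq> bot" using Q.nontrivial by (simp add: filtermap_bot_iff)
    show "eventually P (filtermap ?W ?Q) \<or> (\<forall>\<^sub>F z in filtermap ?W ?Q. \<not> P z)" for P
      using Q.decides[of "\<lambda>\<alpha>. P (?W \<alpha>)"] by (simp add: eventually_filtermap)
    fix P :: "int ^ 'n \<Rightarrow> bool"
    have "eventually P (filtermap ?W ?Q) \<longleftrightarrow> (\<forall>\<^sub>F \<alpha> in ?Q. P (?W \<alpha>))"
      by (simp add: eventually_filtermap)
    also have "\<dots> \<longleftrightarrow> (\<forall>\<^sub>F \<alpha> in ?Q. \<forall>\<^sub>F \<beta> in ?Q. P (?W (\<alpha> \<union> \<beta>)))"
      by (rule eventually_uf_filter_idem[OF q(1,3)]) (simp add: fin_sets_def)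
    also have "\<dots> \<longleftrightarrow> (\<forall>\<^sub>F \<alpha> in ?Q. \<forall>\<^sub>F \<beta> in ?Q. P (?W \<alpha> + ?W \<beta>))"
    proof (rule eventually_cong[OF in_fin])
      fix \<alpha> assume \<alpha>: "\<alpha> \<in> fin_sets"
      from eventually_conj[OF in_fin disjoint[OF \<alpha>]]
      show "(\<forall>\<^sub>F \<beta> in ?Q. P (?W (\<alpha> \<union> \<beta>))) \<longleftrightarrow> (\<forall>\<^sub>F \<beta> in ?Q. P (?W \<alpha> + ?W \<beta>))"
        by (rule eventually_cong) (use additive \<alpha> in auto)
    qed
    also have "\<dots> \<longleftrightarrow> (\<forall>\<^sub>F a in filtermap ?W ?Q. \<forall>\<^sub>F b in filtermap ?W ?Q. P (a + b))"
      by (simp add: eventually_filtermap)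
    finally show "eventually P (filtermap ?W ?Q) \<longleftrightarrow>
        (\<forall>\<^sub>F a in filtermap ?W ?Q. \<forall>\<^sub>F b in filtermap ?W ?Q. P (a + b))" .
  qed
qed

theorem theorem6p1:
  fixes M :: "'a measure" and A :: "'a set" and m :: nat
    and T :: "nat \<Rightarrow> 'a \<Rightarrow> 'a" and f :: "nat \<Rightarrow> 'n::finite rat_poly"
  assumes "prob_space M"
    and "A \<in> sets M"
    and "\<And>i. i \<in> {1..m} \<Longrightarrow> invertible_mpt M (T i)"
    and "\<And>i j x. i \<in> {1..m} \<Longrightarrow> j \<in> {1..m} \<Longrightarrow> x \<in> space M \<Longrightarrow> T i (T j x) = T j (T i x)"
    and "\<And>i. i \<in> {1..m} \<Longrightarrow> f i \<in> int_polys"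
    and "\<And>i. i \<in> {1..m} \<Longrightarrow> poly_val (f i) 0 = 0"
  shows
    "(\<forall>p \<in> ultrafilters (UNIV :: (int ^ 'n) set). uf_idempotent UNIV (+) p \<longrightarrow>
        uf_lim UNIV p (\<lambda>z. measure M
          (A \<inter> (trans_prod M T m (\<lambda>i. int_poly_val (f i) z) -` A \<inter> space M)))
        \<ge> (measure M A)\<^sup>2)
     \<and>
     (\<forall>q \<in> ultrafilters fin_sets. \<forall>w :: 'n \<Rightarrow> nat set \<Rightarrow> nat.
        uncongested q \<longrightarrow> uf_idempotent fin_sets (\<union>) q \<longrightarrow> (\<forall>j. ip_set (w j)) \<longrightarrow>
        uf_lim fin_sets q (\<lambda>\<alpha>. measure M
          (A \<inter> (trans_prod M T m (\<lambda>i. int_poly_val (f i) (\<chi> j. int (w j \<alpha>))) -` A \<inter> space M)))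
        \<ge> (measure M A)\<^sup>2)"
proof -
  interpret commuting_mpts M T m
    using assms(1,3,4) by (simp add: commuting_mpts_def commuting_mpts_axioms_def)
  define \<phi> where
    "\<phi> z = prob (A \<inter> (trans_prod M T m (\<lambda>i. int_poly_val (f i) z) -` A \<inter> space M))" for z
  have recurrence: "(prob A)\<^sup>2 \<le> L" if "idempotent_ultra F" "(\<phi> \<longlongrightarrow> L) F" for F L
  proof (rule polynomial_recurrence[OF assms(2) that(1), of f])
    show "((\<lambda>z. prob (A \<inter> (trans_prod M T m (\<lambda>i. int_poly_val (f i) z) -` A \<inter> space M)))
        \<longlongrightarrow> L) F"
      using that(2) by (simp only: \<phi>_def[abs_def])
  qed (fact assms(5,6))+
  have lim: "((\<lambda>s. \<phi> (W s)) \<longlongrightarrow> uf_lim S p (\<lambda>s. \<phi> (W s))) (uf_filter S p)"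
    if "p \<in> ultrafilters S" for S p and W :: "'s \<Rightarrow> int ^ 'n"
    by (intro tendsto_uf_filter[OF that] has_uf_lim_uf_lim[OF that compact_Icc[of 0 1]])
      (auto simp: \<phi>_def)
  show ?thesis
  proof (intro conjI ballI allI impI)
    fix p :: "(int ^ 'n) set set"
    assume "p \<in> ultrafilters UNIV" "uf_idempotent UNIV (+) p"
    then have "(prob A)\<^sup>2 \<le> uf_lim UNIV p \<phi>"
      using lim[of p UNIV "\<lambda>z. z"] by (intro recurrence[OF idempotent_ultra_uf_filter])
    then show "(prob A)\<^sup>2 \<le> uf_lim UNIV p (\<lambda>z. prob
          (A \<inter> (trans_prod M T m (\<lambda>i. int_poly_val (f i) z) -` A \<inter> space M)))"
      by (simp only: \<phi>_def[abs_def])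
  next
    fix q and w :: "'n \<Rightarrow> nat set \<Rightarrow> nat"
    assume q: "q \<in> ultrafilters fin_sets" "uncongested q" "uf_idempotent fin_sets (\<union>) q"
      and w: "\<forall>j. ip_set (w j)"
    have "(prob A)\<^sup>2 \<le> uf_lim fin_sets q (\<lambda>\<alpha>. \<phi> (\<chi> j. int (w j \<alpha>)))"
    proof (rule recurrence)
      show "idempotent_ultra (filtermap (\<lambda>\<alpha>. \<chi> j. int (w j \<alpha>)) (uf_filter fin_sets q))"
        using w by (intro idempotent_ultra_filtermap_ip q) simp
      show "(\<phi> \<longlongrightarrow> uf_lim fin_sets q (\<lambda>\<alpha>. \<phi> (\<chi> j. int (w j \<alpha>))))
          (filtermap (\<lambda>\<alpha>. \<chi> j. int (w j \<alpha>)) (uf_filter fin_sets q))"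
        unfolding filterlim_filtermap by (rule lim[OF q(1)])
    qed
    then show "(prob A)\<^sup>2 \<le> uf_lim fin_sets q (\<lambda>\<alpha>. prob
          (A \<inter> (trans_prod M T m (\<lambda>i. int_poly_val (f i) (\<chi> j. int (w j \<alpha>))) -` A \<inter> space M)))"
      by (simp only: \<phi>_def)
  qed
qed

end
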